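(* Let $F:\mathbb D\subset\mathbb X\to\mathbb Y$ be an analytic operator, $\mathbb D$ open and convex. Assume that there is an initial point $x_0\in\mathbb D$ such that $F'(x_0)$ is nonsingular, and let $$\gamma:=\sup_{k>1}\left\|\frac{F'(x_0)^{-1}F^{(k)}(x_0)}{k!}\right\|^{\frac1{k-1}}.$$ Let $\{x_k\}$ be the sequence generated by the two-step Newton method with initial point $x_0$. If $0<\alpha:=\beta\gamma\le3-2\sqrt2$, then $\{x_k\}$ is well-defined and converges Q-superquadratically to a solution $x^*\in\overline{\mathbf B(x_0,t^* )}$ of $F(x)=0$, and this solution $x^*$ is unique in $\overline{\mathbf B(x_0,r)}$, where $t^*\le r<t^{**}$ and $$t^*=\frac{1+\alpha-\sqrt{(1+\alpha)^2-8\alpha}}{4\gamma},\qquad t^{**}=\frac{1+\alpha+\sqrt{(1+\alpha)^2-8\alpha}}{4\gamma}.$$ Moreover, when $0<\alpha<3-\sqrt[3]{2}-\sqrt[3]{4}$, the order of convergence is at least cubic (Q-cubic) and $$\|x^*-x_{k+1}\|\le\frac{qH_*^2}{2}\cdot\|x^*-x_k\|^3,\qquad k\ge0,$$ where $$H_*=-\frac{32\gamma}{\sqrt{(1+\alpha)^2-8\alpha}\cdot\left(3-\alpha+\sqrt{(1+\alpha)^2-8\alpha}\right)^2}$$ and $$q:=\frac{\sqrt{(1+\alpha)^2-8\alpha}\cdot(3-\alpha+\sqrt{(1+\alpha)^2-8\alpha})^2+4(1+\alpha-\sqrt{(1+\alpha)^2-8\alpha})}{\sqrt{(1+\alpha)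^2-8\alpha}\cdot(3-\alpha+\sqrt{(1+\alpha)^2-8\alpha})^2-4(1+\alpha-\sqrt{(1+\alpha)^2-8\alpha})}.$$
   Context: $\mathbb X,\mathbb Y$ are Banach spaces; $\mathbf B(x,r)$ is the open ball with center $x$ and radius $r$, and $\overline{\mathbf B(x,r)}$ its closure. It is assumed that $\mathbf B(x_0,r_0)\subset\mathbb D$, where $r_0=\left(1-\frac1{\sqrt2}\right)\frac1\gamma$. Set $\beta:=\|F'(x_0)^{-1}F(x_0)\|$. Two-step Newton method: $y_k=x_k-F'(x_k)^{-1}F(x_k)$, $x_{k+1}=y_k-F'(x_k)^{-1}F(y_k)$, $k=0,1,2,\dots$. $\{x_k\}$ converges to $x^*$ Q-superquadratically if for any $c>0$ there is $N_c\ge0$ with $\|x_{k+1}-x^*\|\le c\|x_k-x^*\|^2$ for all $k\ge N_c$; it converges Q-cubically if there are constants $c\ge0$, $N_c\ge0$ with $\|x_{k+1}-x^*\|\le c\|x_k-x^*\|^3$ for all $k\ge N_c$.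
   Formalization: At α = 3−2√2 the claim fails: for F(t)=β−t+γt²/(1−γt) the zero is double and convergence only linear, and x* may lie outside D. There Q-superquadratic convergence is dropped and F(x* )=0 is claimed only if x* lies in D; all else is kept. *)

theory Defs
  imports "HOL-Analysis.Analysis"
begin

(* A k-linear map X^k -> Y is represented by a function on lists; only its values on lists
   of length k matter. *)

definition multilinear_map :: "nat \<Rightarrow> ('a::real_vector list \<Rightarrow> 'b::real_vector) \<Rightarrow> bool" where
  "multilinear_map k A \<longleftrightarrow>
     (\<forall>hs i. length hs = k \<longrightarrow> i < k \<longrightarrow> linear (\<lambda>v. A (hs[i := v])))"

definition bounded_multilinear ::
    "nat \<Rightarrow> ('a::real_normed_vector list \<Rightarrow> 'b::real_normed_vector) \<Rightarrow> bool" where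
  "bounded_multilinear k A \<longleftrightarrow> multilinear_map k A \<and>
     (\<exists>C. \<forall>hs. length hs = k \<longrightarrow> norm (A hs) \<le> C * prod_list (map norm hs))"

definition symmetric_map :: "nat \<Rightarrow> ('a list \<Rightarrow> 'b) \<Rightarrow> bool" where
  "symmetric_map k A \<longleftrightarrow>
     (\<forall>hs hs'. length hs = k \<longrightarrow> mset hs' = mset hs \<longrightarrow> A hs' = A hs)"

definition multilinear_norm ::
    "nat \<Rightarrow> ('a::real_normed_vector list \<Rightarrow> 'b::real_normed_vector) \<Rightarrow> real" where
  "multilinear_norm k A =
     (SUP hs \<in> {hs. length hs = k \<and> (\<forall>h\<in>set hs. norm h \<le> 1)}. norm (A hs))"

(* Analyticity between Banach spaces: around every point of D there is an expansion
   F(a + h) = sum_n A_n(h,...,h) into bounded symmetric n-linear maps, normally convergent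
   on some ball. The scalars are real; a complex Banach space is covered through its
   underlying real one, with the same derivatives and the same norms. *)

definition analytic_operator_on ::
    "('a::real_normed_vector \<Rightarrow> 'b::real_normed_vector) \<Rightarrow> 'a set \<Rightarrow> bool" where
  "analytic_operator_on F D \<longleftrightarrow> (\<forall>a\<in>D. \<exists>r>0. \<exists>A.
     (\<forall>n. bounded_multilinear n (A n) \<and> symmetric_map n (A n)) \<and>
     summable (\<lambda>n. multilinear_norm n (A n) * r ^ n) \<and>
     (\<forall>h. norm h < r \<longrightarrow> (\<lambda>n. A n (replicate n h)) sums F (a + h)))"

abbreviation fderiv ::
    "('a::real_normed_vector \<Rightarrow> 'b::real_normed_vector) \<Rightarrow> 'a \<Rightarrow> 'a \<Rightarrow> 'b" where
  "fderiv F x \<equiv> frechet_derivative F (at x)"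

(* nth_fderiv F k x [h1,...,hk] is F^(k)(x)[h1,...,hk]. The k-th derivatives cannot be
   iterated as a map into spaces of operators, whose type would depend on k, so the
   arguments h2,...,hk are frozen when differentiating once more in x. *)

primrec nth_fderiv ::
    "('a::real_normed_vector \<Rightarrow> 'b::real_normed_vector) \<Rightarrow> nat \<Rightarrow> 'a \<Rightarrow> 'a list \<Rightarrow> 'b" where
  "nth_fderiv F 0 x hs = F x"
| "nth_fderiv F (Suc k) x hs = fderiv (\<lambda>z. nth_fderiv F k z (tl hs)) x (hd hs)"

definition nonsingular ::
    "('a::real_normed_vector \<Rightarrow> 'b::real_normed_vector) \<Rightarrow> bool" where
  "nonsingular L \<longleftrightarrow> bounded_linear L \<and> bij L \<and> bounded_linear (inv L)"

(* The supremum is taken in the reals; analyticity at x0 makes the set bounded. *)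

definition gamma_number ::
    "('a::real_normed_vector \<Rightarrow> 'b::real_normed_vector) \<Rightarrow> 'a \<Rightarrow> real" where
  "gamma_number F x0 = (SUP k\<in>{k. k > 1}. root (k - 1)
     (multilinear_norm k (\<lambda>hs. inv (fderiv F x0) (nth_fderiv F k x0 hs) /\<^sub>R fact k)))"

definition newton_step ::
    "('a::real_normed_vector \<Rightarrow> 'b::real_normed_vector) \<Rightarrow> 'a \<Rightarrow> 'a" where
  "newton_step F x = x - inv (fderiv F x) (F x)"

primrec two_step_newton ::
    "('a::real_normed_vector \<Rightarrow> 'b::real_normed_vector) \<Rightarrow> 'a \<Rightarrow> nat \<Rightarrow> 'a" where
  "two_step_newton F x0 0 = x0"
| "two_step_newton F x0 (Suc k) =
     (let x = two_step_newton F x0 k; y = newton_step F x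
      in y - inv (fderiv F x) (F y))"

(* All operations are total in HOL, so this records that F, F' and the inverse are only
   ever used where they make sense. *)

definition two_step_newton_well_defined ::
    "('a::real_normed_vector \<Rightarrow> 'b::real_normed_vector) \<Rightarrow> 'a set \<Rightarrow> 'a \<Rightarrow> bool" where
  "two_step_newton_well_defined F D x0 \<longleftrightarrow>
     (\<forall>k. let x = two_step_newton F x0 k in
        x \<in> D \<and> nonsingular (fderiv F x) \<and> newton_step F x \<in> D)"

definition converges_Q_superquadratically ::
    "(nat \<Rightarrow> 'a::real_normed_vector) \<Rightarrow> 'a \<Rightarrow> bool" where
  "converges_Q_superquadratically x l \<longleftrightarrow> x \<longlonglongrightarrow> l \<and>
     (\<forall>c>0. \<exists>N. \<forall>k\<ge>N. norm (x (Suc k) - l) \<le> c * norm (x k - l) ^ 2)"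

definition converges_Q_cubically ::
    "(nat \<Rightarrow> 'a::real_normed_vector) \<Rightarrow> 'a \<Rightarrow> bool" where
  "converges_Q_cubically x l \<longleftrightarrow> x \<longlonglongrightarrow> l \<and>
     (\<exists>c\<ge>0. \<exists>N. \<forall>k\<ge>N. norm (x (Suc k) - l) \<le> c * norm (x k - l) ^ 3)"

end

theory Submission
  imports Defs
begin

text \<open>
  Put \<open>G = F'(x0)\<^sup>-\<^sup>1 F\<close>; Newton steps for \<open>F\<close> and \<open>G\<close> agree. The Taylor coefficients \<open>B\<^sub>k\<close> of \<open>G\<close> at \<open>x0\<close>
  satisfy \<open>norm B\<^sub>k \<le> \<gamma> ^ (k - 1)\<close> for \<open>k \<ge> 1\<close>, and by analytic continuation along segments \<open>G\<close> is
  the sum of its Taylor series on \<open>D \<inter> ball x0 (1 / \<gamma>)\<close>. Comparing the series term by term with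
  Smale's majorant \<open>h t = \<beta> - t + \<gamma> * t\<^sup>2 / (1 - \<gamma> * t)\<close>, whose zeros are \<open>tstar\<close> and \<open>tsstar\<close>, gives
  \<open>norm (G' w - G' x) \<le> h' (a + d) - h' a\<close> when \<open>norm (x - x0) \<le> a\<close> and \<open>norm (w - x) \<le> d\<close>. Hence
  the two-step Newton sequence of \<open>h\<close> started at \<open>0\<close> majorizes the one of \<open>G\<close>. A zero \<open>z\<close> of \<open>G\<close> with
  \<open>norm (z - x0) < tsstar\<close> forces
  \<open>0 \<le> h (norm (z - x0))\<close>, which confines it to the closed ball of radius \<open>tstar\<close>, where \<open>G\<close> differs from
  the identity by a contraction. The cubic estimate uses the Lipschitz constant \<open>h'' tstar\<close> of
  \<open>G'\<close> and the bound \<open>- 1 / h' tstar\<close> for its inverse on that ball.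
\<close>

section \<open>Normed power series between Banach spaces\<close>

text \<open>Two radii must be kept apart. Analyticity at \<open>x0\<close> gives agreement of
  \<open>F\<close> with its Taylor series only on a ball of unknown radius, whereas \<gamma>
  controls the coefficients and makes the series converge on the ball of radius
  \<open>1 / \<gamma>\<close>, which \<open>D\<close> need not contain. The iterates and the zeros
  in the uniqueness claim may leave the small ball, so the equality has to be carried further;
  convexity of \<open>D\<close> reduces this to an identity theorem in one real parameter. After
  normalization the derivative at \<open>x0\<close> is the identity. Estimates of derivatives can
  then be stated on a single vector, without a norm on operators, and invertibility is a
  perturbation of the identity. The radius \<open>r0\<close> is the zero of the derivative of the
  majorant, so \<open>tstar < r0\<close> says that \<open>tstar\<close> is a simple zero. The error
  is cubic in the whole range \<alpha> < 3 - 2 sqrt 2; the smaller threshold is the one at which the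
  denominator of \<open>q\<close> changes sign.\<close>

lemma termdiff_summable:
  fixes c :: "nat \<Rightarrow> real"
  assumes "\<And>x. \<bar>x\<bar> < R \<Longrightarrow> summable (\<lambda>n. c n * x ^ n)" and "\<bar>x\<bar> < R"
  shows "summable (\<lambda>n. (1 + real n) * c (Suc n) * x ^ n)"
  using termdiff_converges[of x R c] assms by (simp add: diffs_def)

lemma prod_list_norm_nonneg: "0 \<le> prod_list (map norm us)"
  for us :: "'x::real_normed_vector list"
  by (induction us) auto

lemma norm_sums_le_sums:
  fixes f :: "nat \<Rightarrow> 'x::banach"
  assumes "f sums a" and "g sums b" and "\<And>n. norm (f n) \<le> g n"
  shows "norm a \<le> b"
  using norm_suminf_le[OF assms(3) sums_summable[OF assms(2)]] assms(1,2) by (simp add: sums_iff)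

text \<open>The bounds \<open>c\<close> are a parameter because three choices occur: the multilinear
  norms for the expansion of \<open>F\<close>, a geometric sequence for the normalized operator, and
  rescaled shifts for directional derivatives. \<open>R\<close> is a radius guaranteed by
  \<open>c\<close> alone.\<close>

locale normed_power_series =
  fixes B :: "nat \<Rightarrow> 'a::real_normed_vector list \<Rightarrow> 'b::banach"
    and c :: "nat \<Rightarrow> real" and R :: real
  assumes multilinear: "multilinear_map n (B n)"
    and symmetric: "symmetric_map n (B n)"
    and bound: "length hs = n \<Longrightarrow> norm (B n hs) \<le> c n * prod_list (map norm hs)"
    and c_nonneg: "0 \<le> c n"
    and summable_c: "\<bar>x\<bar> < R \<Longrightarrow> summable (\<lambda>n. c n * x ^ n)"
begin

definition psum :: "'a \<Rightarrow> 'b" where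
  "psum v = (\<Sum>n. B n (replicate n v))"

definition pderivative :: "'a \<Rightarrow> 'a \<Rightarrow> 'b" where
  "pderivative v u = (\<Sum>n. (1 + real n) *\<^sub>R B (Suc n) (u # replicate n v))"

section \<open>Multilinear maps on nearly diagonal arguments\<close>

lemma linear_Cons:
  assumes "length hs = n"
  shows "linear (\<lambda>v. B (Suc n) (v # hs))"
  using multilinear[of "Suc n"] assms unfolding multilinear_map_def
  by (auto dest!: spec[of _ "undefined # hs"] spec[of _ 0])

lemma permute:
  assumes "length hs = n" and "mset hs' = mset hs"
  shows "B n hs' = B n hs"
  using symmetric[of n] assms unfolding symmetric_map_def by blast

lemma norm_replicate_append:
  assumes "n + length us = N"
  shows "norm (B N (replicate n v @ us)) \<le> c N * (norm v ^ n * prod_list (map norm us))"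
  using bound[of "replicate n v @ us" N] assms by (simp add: mult.assoc)

lemma norm_Cons_replicate_append:
  assumes "Suc (n + length us) = N"
  shows "norm (B N (k # replicate n v @ us)) \<le> c N * (norm k * norm v ^ n * prod_list (map norm us))"
  using bound[of "k # replicate n v @ us" N] assms by (simp add: mult.assoc)

text \<open>Telescoping: copies of \<open>w\<close> are traded for \<open>v\<close> one at a time,
  each trade producing one argument \<open>w - v\<close>. The tail \<open>us\<close> stores the
  arguments already traded, which closes the induction, and later carries the direction of a
  derivative.\<close>

lemma replicate_diff_bound:
  assumes "n + length us = N"
  shows "norm (B N (replicate n w @ us) - B N (replicate n v @ us))
    \<le> c N * norm (w - v) * (\<Sum>j<n. norm w ^ j * norm v ^ (n - Suc j)) * prod_list (map norm us)"
  using assms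
proof (induction n arbitrary: us)
  case 0
  then show ?case by simp
next
  case (Suc n)
  have N: "N = Suc (n + length us)" using Suc.prems by simp
  interpret L: linear "\<lambda>x. B N (x # replicate n w @ us)"
    unfolding N by (rule linear_Cons) simp
  have p: "B N (x # replicate n y @ us) = B N (replicate n y @ (x # us))" for x y
    by (rule permute) (simp_all add: N)
  have 1: "B N (replicate (Suc n) w @ us) - B N (replicate (Suc n) v @ us)
    = B N ((w - v) # replicate n w @ us)
      + (B N (replicate n w @ (v # us)) - B N (replicate n v @ (v # us)))"
    by (simp add: L.diff flip: p)
  have 2: "norm (B N ((w - v) # replicate n w @ us))
    \<le> c N * norm (w - v) * norm w ^ n * prod_list (map norm us)"
    using norm_Cons_replicate_append[of n us N "w - v" w] N by (simp add: mult.assoc)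
  have 3: "norm (B N (replicate n w @ (v # us)) - B N (replicate n v @ (v # us)))
    \<le> c N * norm (w - v) * (\<Sum>j<n. norm w ^ j * norm v ^ (n - Suc j)) * prod_list (map norm (v # us))"
    by (rule Suc.IH) (simp add: N)
  have 4: "(\<Sum>j<Suc n. norm w ^ j * norm v ^ (Suc n - Suc j))
     = norm w ^ n + (\<Sum>j<n. norm w ^ j * norm v ^ (n - Suc j)) * norm v"
    by (auto simp: sum_distrib_right Suc_diff_Suc intro!: sum.cong
        simp flip: power_Suc2 simp: mult.assoc)
  show ?case
    unfolding 1 4 by (rule norm_triangle_le) (use 2 3 in \<open>simp add: algebra_simps\<close>)
qed

text \<open>Replacing the norms by \<open>a + d\<close> and \<open>a\<close> turns the telescoping
  sum into the factorization of a difference of powers, so the bound is the increment of a scalar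
  power. Summed over \<open>n\<close>, these increments produce the majorant.\<close>

lemma replicate_diff_bound_power:
  assumes "n + length us = N" and "norm v \<le> a" and "norm (w - v) \<le> d"
  shows "norm (B N (replicate n w @ us) - B N (replicate n v @ us))
    \<le> c N * ((a + d) ^ n - a ^ n) * prod_list (map norm us)"
proof -
  have d: "0 \<le> d" and a: "0 \<le> a"
    using assms(2,3) norm_ge_zero order_trans by blast+
  have w: "norm w \<le> a + d"
    using norm_triangle_ineq[of v "w - v"] assms by simp
  have "norm (w - v) * (\<Sum>j<n. norm w ^ j * norm v ^ (n - Suc j))
    \<le> d * (\<Sum>j<n. (a + d) ^ j * a ^ (n - Suc j))"
    by (intro mult_mono sum_mono power_mono sum_nonneg) (use assms w a d in auto)
  also have "\<dots> = (a + d) ^ n - a ^ n"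
    by (cases n) (simp_all only: diff_power_eq_sum, simp_all)
  finally have "c N * (norm (w - v) * (\<Sum>j<n. norm w ^ j * norm v ^ (n - Suc j))) * prod_list (map norm us)
     \<le> c N * ((a + d) ^ n - a ^ n) * prod_list (map norm us)"
    by (intro mult_right_mono mult_left_mono prod_list_norm_nonneg c_nonneg)
  then show ?thesis
    using replicate_diff_bound[OF assms(1), of w v] by (simp add: mult.assoc)
qed

lemma replicate_diff_bound_Lipschitz:
  assumes "n + length us = N" and "norm v \<le> \<rho>" and "norm w \<le> \<rho>"
  shows "norm (B N (replicate n w @ us) - B N (replicate n v @ us))
    \<le> c N * norm (w - v) * (real n * \<rho> ^ (n - 1)) * prod_list (map norm us)"
proof -
  have \<rho>: "0 \<le> \<rho>" using assms norm_ge_zero order_trans by blast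
  have "(\<Sum>j<n. norm w ^ j * norm v ^ (n - Suc j)) \<le> (\<Sum>j<n. \<rho> ^ j * \<rho> ^ (n - Suc j))"
    by (intro mult_mono sum_mono power_mono sum_nonneg) (use assms \<rho> in auto)
  also have "\<dots> = real n * \<rho> ^ (n - 1)"
    by (simp flip: power_add)
  finally have "c N * norm (w - v) * (\<Sum>j<n. norm w ^ j * norm v ^ (n - Suc j)) * prod_list (map norm us)
     \<le> c N * norm (w - v) * (real n * \<rho> ^ (n - 1)) * prod_list (map norm us)"
    by (intro mult_right_mono mult_left_mono prod_list_norm_nonneg mult_nonneg_nonneg c_nonneg) auto
  then show ?thesis
    using replicate_diff_bound[OF assms(1), of w v] by simp
qed

text \<open>Peeling off one argument leaves a first-order difference with \<open>w - v\<close>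
  parked in the tail, plus the remainder for one copy fewer. The two factors add up by
  \<open>n + n * (n - 1) \<le> (n + 1) * n\<close>. Quadratic order in \<open>w - v\<close> is what
  differentiability of the sum requires.\<close>

lemma replicate_linearization_bound:
  assumes "n + length us = N" and "norm v \<le> \<rho>" and "norm w \<le> \<rho>"
  shows "norm (B N (replicate n w @ us) - B N (replicate n v @ us)
        - real n *\<^sub>R B N ((w - v) # replicate (n - 1) v @ us))
    \<le> c N * (norm (w - v))\<^sup>2 * (real n * (real n - 1) * \<rho> ^ (n - 2)) * prod_list (map norm us)"
  using assms(1)
proof (induction n arbitrary: us)
  case 0
  then show ?case by simp
next
  case (Suc n)
  have \<rho>: "0 \<le> \<rho>" using assms norm_ge_zero order_trans by blast
  have N: "N = Suc (n + length us)" using Suc.prems by simp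
  let ?k = "w - v"
  interpret L: linear "\<lambda>x. B N (x # replicate n w @ us)"
    unfolding N by (rule linear_Cons) simp
  have p: "B N (x # replicate n y @ us) = B N (replicate n y @ (x # us))" for x y
    by (rule permute) (simp_all add: N)
  \<comment> \<open>For \<open>n = 0\<close> the list on the right is one entry too long, but the
    scalar factor is then \<open>0\<close>.\<close>
  have k: "real n *\<^sub>R B N (?k # replicate n v @ us)
     = real n *\<^sub>R B N (?k # replicate (n - 1) v @ (v # us))"
    by (cases n) (auto intro!: permute simp: N)
  have "B N (replicate (Suc n) w @ us) - B N (replicate (Suc n) v @ us)
        - real (Suc n) *\<^sub>R B N (?k # replicate (Suc n - 1) v @ us)
    = (B N (?k # replicate n w @ us) - B N (?k # replicate n v @ us))
      + (B N (replicate n w @ (v # us)) - B N (replicate n v @ (v # us))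
        - real n *\<^sub>R B N (?k # replicate n v @ us))"
    by (simp add: L.diff algebra_simps flip: p)
  also have "\<dots> = (B N (replicate n w @ (?k # us)) - B N (replicate n v @ (?k # us)))
      + (B N (replicate n w @ (v # us)) - B N (replicate n v @ (v # us))
        - real n *\<^sub>R B N (?k # replicate (n - 1) v @ (v # us)))" (is "_ = ?X + ?Y")
    unfolding k by (simp only: p)
  finally have eq: "B N (replicate (Suc n) w @ us) - B N (replicate (Suc n) v @ us)
        - real (Suc n) *\<^sub>R B N (?k # replicate (Suc n - 1) v @ us) = ?X + ?Y" .
  let ?p = "prod_list (map norm us)"
  have X: "norm ?X \<le> c N * (norm ?k)\<^sup>2 * ?p * (real n * \<rho> ^ (n - 1))"
    using replicate_diff_bound_Lipschitz[of n "?k # us" N v \<rho> w] assms N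
    by (simp add: power2_eq_square mult_ac)
  have "norm ?Y \<le> c N * (norm ?k)\<^sup>2 * (real n * (real n - 1) * \<rho> ^ (n - 2)) * prod_list (map norm (v # us))"
    by (rule Suc.IH) (simp add: N)
  also have "\<dots> \<le> c N * (norm ?k)\<^sup>2 * ?p * (real n * (real n - 1) * \<rho> ^ (n - 2) * \<rho>)"
  proof -
    have nn: "0 \<le> real n * (real n - 1) * \<rho> ^ (n - 2)"
      using \<rho> by (cases n) auto
    have "c N * (norm ?k)\<^sup>2 * (real n * (real n - 1) * \<rho> ^ (n - 2)) * ?p * norm v
       \<le> c N * (norm ?k)\<^sup>2 * (real n * (real n - 1) * \<rho> ^ (n - 2)) * ?p * \<rho>"
      using c_nonneg[of N] nn prod_list_norm_nonneg[of us] assms(2)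
      by (metis mult_left_mono mult_nonneg_nonneg zero_le_power2)
    then show ?thesis by (simp add: mult_ac)
  qed
  also have "\<dots> = c N * (norm ?k)\<^sup>2 * ?p * (real n * (real n - 1) * \<rho> ^ (n - 1))"
  proof (cases "n \<le> 1")
    case True
    then have "n = 0 \<or> n = 1" by auto
    then show ?thesis by auto
  next
    case False
    then obtain m where "n = Suc (Suc m)" by (metis One_nat_def not0_implies_Suc not_less_eq_eq le0)
    then show ?thesis by simp
  qed
  finally have Y: "norm ?Y \<le> c N * (norm ?k)\<^sup>2 * ?p * (real n * (real n - 1) * \<rho> ^ (n - 1))" .
  have "norm (?X + ?Y) \<le> c N * (norm ?k)\<^sup>2 * ?p * (real n * real n * \<rho> ^ (n - 1))"
    by (rule norm_triangle_le) (use X Y in \<open>simp add: algebra_simps\<close>)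
  also have "\<dots> \<le> c N * (norm ?k)\<^sup>2 * ?p * (real (Suc n) * (real (Suc n) - 1) * \<rho> ^ (Suc n - 2))"
  proof (intro mult_left_mono)
    have "real n * real n * \<rho> ^ (n - 1) \<le> (real (Suc n) * real n) * \<rho> ^ (n - 1)"
      by (rule mult_right_mono) (use \<rho> in \<open>auto intro: mult_right_mono\<close>)
    then show "real n * real n * \<rho> ^ (n - 1) \<le> real (Suc n) * (real (Suc n) - 1) * \<rho> ^ (Suc n - 2)"
      by (simp add: numeral_2_eq_2)
    show "0 \<le> c N * (norm ?k)\<^sup>2 * ?p"
      by (intro mult_nonneg_nonneg c_nonneg prod_list_norm_nonneg) simp
  qed
  finally show ?case unfolding eq by (simp add: mult_ac)
qed

section \<open>The sum of the series and its derivative\<close>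

lemma summable_terms:
  assumes "norm v < R"
  shows "summable (\<lambda>n. B n (replicate n v))"
proof (rule summable_comparison_test')
  show "summable (\<lambda>n. c n * norm v ^ n)" by (rule summable_c) (use assms in simp)
  show "norm (B n (replicate n v)) \<le> c n * norm v ^ n" for n
    using norm_replicate_append[of n "[]" n v] by simp
qed

lemma psum_sums:
  assumes "norm v < R"
  shows "(\<lambda>n. B n (replicate n v)) sums psum v"
  unfolding psum_def by (rule summable_sums[OF summable_terms[OF assms]])

lemma psum_0: "psum 0 = B 0 []"
proof -
  have "B n (replicate n 0) = 0" if "n > 0" for n
    using norm_replicate_append[of n "[]" n 0] that by (simp add: power_0_left)
  then have "psum 0 = (\<Sum>n\<in>{0}. B n (replicate n 0))"
    unfolding psum_def by (intro suminf_finite) auto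
  then show ?thesis by simp
qed

lemma norm_derivative_term:
  "norm ((1 + real n) *\<^sub>R B (Suc n) (u # replicate n v)) \<le> (1 + real n) * c (Suc n) * norm v ^ n * norm u"
  using mult_left_mono[OF norm_Cons_replicate_append[of n "[]" "Suc n" u v], of "1 + real n"]
  by (simp add: mult_ac)

lemma summable_derivative_terms:
  assumes "norm v < R"
  shows "summable (\<lambda>n. (1 + real n) *\<^sub>R B (Suc n) (u # replicate n v))"
proof (rule summable_comparison_test')
  show "summable (\<lambda>n. (1 + real n) * c (Suc n) * norm v ^ n * norm u)"
    by (intro summable_mult2 termdiff_summable[where R = R] summable_c) (use assms in auto)
qed (rule norm_derivative_term)

lemma pderivative_sums:
  assumes "norm v < R"
  shows "(\<lambda>n. (1 + real n) *\<^sub>R B (Suc n) (u # replicate n v)) sums pderivative v u"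
  unfolding pderivative_def by (rule summable_sums[OF summable_derivative_terms[OF assms]])

lemma pderivative_0: "pderivative 0 u = B 1 [u]"
proof -
  have "B (Suc n) (u # replicate n 0) = 0" if "n \<noteq> 0" for n
    using norm_Cons_replicate_append[of n "[]" "Suc n" u 0] that by (simp add: power_0_left)
  then have "pderivative 0 u = (\<Sum>n\<in>{0}. (1 + real n) *\<^sub>R B (Suc n) (u # replicate n 0))"
    unfolding pderivative_def by (intro suminf_finite) auto
  then show ?thesis by simp
qed

lemma bounded_linear_pderivative:
  assumes v: "norm v < R"
  shows "bounded_linear (pderivative v)"
proof (rule bounded_linear_intro)
  have l: "linear (\<lambda>u. B (Suc n) (u # replicate n v))" for n
    by (rule linear_Cons) simp
  show "pderivative v (x + y) = pderivative v x + pderivative v y" for x y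
  proof -
    have "(\<lambda>n. (1 + real n) *\<^sub>R B (Suc n) ((x + y) # replicate n v)) sums (pderivative v x + pderivative v y)"
      using sums_add[OF pderivative_sums[OF v, of x] pderivative_sums[OF v, of y]]
      by (simp add: linear_add[OF l] scaleR_add_right)
    then show ?thesis using pderivative_sums[OF v] sums_unique2 by blast
  qed
  show "pderivative v (r *\<^sub>R x) = r *\<^sub>R pderivative v x" for r x
  proof -
    have "(\<lambda>n. (1 + real n) *\<^sub>R B (Suc n) ((r *\<^sub>R x) # replicate n v)) sums (r *\<^sub>R pderivative v x)"
      using sums_scaleR_right[OF pderivative_sums[OF v, of x], of r]
      by (simp add: linear_scale[OF l] mult.commute)
    then show ?thesis using pderivative_sums[OF v] sums_unique2 by blast
  qed
  have s: "summable (\<lambda>n. (1 + real n) * c (Suc n) * norm v ^ n)"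
    by (intro termdiff_summable[where R = R] summable_c) (use v in auto)
  show "norm (pderivative v x) \<le> norm x * (\<Sum>n. (1 + real n) * c (Suc n) * norm v ^ n)" for x
    using norm_sums_le_sums[OF pderivative_sums[OF v] sums_mult2[OF summable_sums[OF s]]
        norm_derivative_term]
    by (simp add: mult.commute)
qed

text \<open>The termwise remainders add up to \<open>(norm (w - v))\<^sup>2\<close> times the sum of
  \<open>e\<close>, a formal second derivative of the scalar series at \<rho>. The intermediate
  radius leaves room for all \<open>w\<close> near \<open>v\<close> while \<open>e\<close> stays
  summable.\<close>

theorem has_derivative_psum:
  assumes v: "norm v < R"
  shows "(psum has_derivative pderivative v) (at v)"
proof -
  obtain \<rho> where \<rho>: "norm v < \<rho>" "\<rho> < R" using dense[OF v] by blast
  then have \<rho>0: "0 < \<rho>" using norm_ge_zero le_less_trans by blast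
  define e where "e n = c n * (real n * (real n - 1) * \<rho> ^ (n - 2))" for n
  have "summable (\<lambda>n. (1 + real n) * ((1 + real (Suc n)) * c (Suc (Suc n))) * \<rho> ^ n)"
    by (rule termdiff_summable[of R "\<lambda>n. (1 + real n) * c (Suc n)"])
      (use termdiff_summable[OF summable_c] \<rho> \<rho>0 in auto)
  then have "summable (\<lambda>n. e (Suc (Suc n)))"
    unfolding e_def by (simp add: mult_ac)
  then have e: "summable e"
    using summable_iff_shift[of e 2] by (simp add: numeral_2_eq_2)
  show ?thesis
  proof (rule has_derivativeI_sandwich[where H = "\<lambda>w. norm (w - v) * suminf e"])
    show "0 < \<rho> - norm v" using \<rho> by simp
    show "bounded_linear (pderivative v)" by (rule bounded_linear_pderivative[OF v])
    have "((\<lambda>w. norm (w - v) * suminf e) \<longlongrightarrow> norm (v - v) * suminf e) (at v)"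
      by (intro tendsto_intros)
    then show "((\<lambda>w. norm (w - v) * suminf e) \<longlongrightarrow> 0) (at v)" by simp
    fix w assume w: "w \<noteq> v" "dist w v < \<rho> - norm v"
    have nw: "norm w < \<rho>"
      using w norm_triangle_ineq[of v "w - v"] by (simp add: dist_norm)
    have d: "(\<lambda>n. real n *\<^sub>R B n ((w - v) # replicate (n - 1) v)) sums pderivative v (w - v)"
      using pderivative_sums[OF v, of "w - v"]
        sums_Suc_iff[of "\<lambda>n. real n *\<^sub>R B n ((w - v) # replicate (n - 1) v)" "pderivative v (w - v)"]
      by simp
    have "(\<lambda>n. B n (replicate n w) - B n (replicate n v) - real n *\<^sub>R B n ((w - v) # replicate (n - 1) v))
       sums (psum w - psum v - pderivative v (w - v))"
      by (intro sums_diff d psum_sums) (use nw \<rho> v in auto)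
    moreover have "norm (B n (replicate n w) - B n (replicate n v)
        - real n *\<^sub>R B n ((w - v) # replicate (n - 1) v)) \<le> (norm (w - v))\<^sup>2 * e n" for n
      using replicate_linearization_bound[of n "[]" n v \<rho> w] nw \<rho>
      by (simp add: e_def mult_ac)
    ultimately have "norm (psum w - psum v - pderivative v (w - v)) \<le> (norm (w - v))\<^sup>2 * suminf e"
      by (intro norm_sums_le_sums[OF _ sums_mult[OF summable_sums[OF e]]])
    then show "norm (psum w - psum v - pderivative v (w - v)) / norm (w - v) \<le> norm (w - v) * suminf e"
      using w(1) by (simp add: divide_simps power2_eq_square mult_ac)
  qed
qed

text \<open>The bridge from coefficient estimates to the derivative, used once with increments of
  powers and once with a Lipschitz bound. The direction \<open>u\<close> stands last to match the
  tail \<open>us\<close> of those estimates.\<close>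

lemma pderivative_diff_bound:
  assumes "norm v < R" and "norm w < R"
    and le: "\<And>n. norm (B (Suc n) (replicate n w @ [u]) - B (Suc n) (replicate n v @ [u]))
        \<le> e n * norm u"
    and "(\<lambda>n. (1 + real n) * e n) sums E"
  shows "norm (pderivative w u - pderivative v u) \<le> E * norm u"
proof -
  have "(\<lambda>n. (1 + real n) *\<^sub>R (B (Suc n) (u # replicate n w) - B (Suc n) (u # replicate n v)))
      sums (pderivative w u - pderivative v u)"
    using sums_diff[OF pderivative_sums[OF assms(2), of u] pderivative_sums[OF assms(1), of u]]
    by (simp add: scaleR_diff_right)
  moreover have "norm ((1 + real n) *\<^sub>R (B (Suc n) (u # replicate n w) - B (Suc n) (u # replicate n v)))
      \<le> (1 + real n) * e n * norm u" for n
  proof -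
    have "B (Suc n) (u # replicate n x) = B (Suc n) (replicate n x @ [u])" for x
      by (rule permute) auto
    then show ?thesis
      using mult_left_mono[OF le[of n], of "1 + real n"] by (simp add: mult.assoc)
  qed
  ultimately show ?thesis
    by (rule norm_sums_le_sums[OF _ sums_mult2[OF assms(4)]])
qed

end

section \<open>Higher derivatives and Smale's number\<close>

text \<open>
  The coefficients of the power series of the derivative in direction \<open>u\<close>; iterating along a list of
  directions yields the higher derivatives \<^const>\<open>nth_fderiv\<close>.
\<close>

definition shift_coeff ::
    "'a \<Rightarrow> (nat \<Rightarrow> 'a list \<Rightarrow> 'b::real_normed_vector) \<Rightarrow> nat \<Rightarrow> 'a list \<Rightarrow> 'b" where
  "shift_coeff u B n vs = (1 + real n) *\<^sub>R B (Suc n) (u # vs)"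

text \<open>The outermost direction is inserted first and the inner ones are put in front of it,
  hence the reversal. At \<open>n = 0\<close> the factor is \<open>fact (length hs)\<close>, which
  \<open>gamma_number\<close> divides out.\<close>

lemma foldr_shift_coeff:
  "foldr shift_coeff hs B n vs
    = (fact (n + length hs) / fact n) *\<^sub>R B (n + length hs) (rev hs @ vs)"
proof (induction hs arbitrary: n vs)
  case (Cons u hs)
  have "foldr shift_coeff (u # hs) B n vs
      = (1 + real n) *\<^sub>R foldr shift_coeff hs B (Suc n) (u # vs)"
    unfolding foldr.simps o_apply by (rule shift_coeff_def)
  also have "\<dots> = ((1 + real n) * (fact (Suc n + length hs) / fact (Suc n)))
      *\<^sub>R B (Suc n + length hs) (rev hs @ u # vs)"
    by (simp only: Cons.IH scaleR_scaleR)
  also have "(1 + real n) * (fact (Suc n + length hs) / fact (Suc n)) = fact (n + length (u # hs)) / fact n"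
    by (simp add: divide_simps)
  finally show ?case by simp
qed simp

context normed_power_series
begin

lemma shift_power_series:
  "normed_power_series (shift_coeff u B) (\<lambda>n. (1 + real n) * c (Suc n) * norm u) R"
proof
  show "multilinear_map n (shift_coeff u B n)" for n
    unfolding multilinear_map_def
  proof (intro allI impI)
    fix hs :: "'a list" and i assume "length hs = n" "i < n"
    then have "linear (\<lambda>v. B (Suc n) ((u # hs)[Suc i := v]))"
      using multilinear[of "Suc n"] unfolding multilinear_map_def
      by (metis Suc_less_eq length_Cons)
    then show "linear (\<lambda>v. shift_coeff u B n (hs[i := v]))"
      unfolding shift_coeff_def by (simp add: linear_compose_scale_right)
  qed
  show "symmetric_map n (shift_coeff u B n)" for n
    unfolding symmetric_map_def
  proof (intro allI impI)
    fix hs hs' :: "'a list" assume "length hs = n" "mset hs' = mset hs"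
    then have "B (Suc n) (u # hs') = B (Suc n) (u # hs)"
      by (intro permute) auto
    then show "shift_coeff u B n hs' = shift_coeff u B n hs"
      by (simp add: shift_coeff_def)
  qed
  show "norm (shift_coeff u B n hs) \<le> (1 + real n) * c (Suc n) * norm u * prod_list (map norm hs)"
    if "length hs = n" for n hs
    using mult_left_mono[OF bound[of "u # hs" "Suc n"], of "1 + real n"] that
    by (simp add: shift_coeff_def mult_ac)
  show "0 \<le> (1 + real n) * c (Suc n) * norm u" for n
    using c_nonneg by simp
  show "summable (\<lambda>n. (1 + real n) * c (Suc n) * norm u * x ^ n)" if "\<bar>x\<bar> < R" for x
    using summable_mult2[OF termdiff_summable[OF summable_c that], of "norm u"]
    by (simp add: mult_ac)
qed

lemma psum_shift: "normed_power_series.psum (shift_coeff u B) v = pderivative v u"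
  using shift_power_series[of u]
  by (simp add: normed_power_series.psum_def shift_coeff_def pderivative_def)

lemma foldr_shift_power_series: "\<exists>c'. normed_power_series (foldr shift_coeff hs B) c' R"
proof (induction hs)
  case Nil
  show ?case using normed_power_series_axioms by auto
next
  case (Cons u hs)
  then show ?case using normed_power_series.shift_power_series by fastforce
qed

text \<open>The induction covers all \<open>v\<close> in the ball at once: one more differentiation
  requires the formula for the lower derivative near the point, not only at it.\<close>

lemma nth_fderiv_psum:
  assumes F: "\<And>v. norm v < R \<Longrightarrow> F (a + v) = psum v" and v: "norm v < R"
  shows "nth_fderiv F (length hs) (a + v) hs
    = normed_power_series.psum (foldr shift_coeff hs B) v"
  using v
proof (induction hs arbitrary: v)
  case Nil
  then show ?case using F by simp
next
  case (Cons u hs)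
  obtain c' where "normed_power_series (foldr shift_coeff hs B) c' R"
    using foldr_shift_power_series by blast
  then interpret N: normed_power_series "foldr shift_coeff hs B" c' R .
  have "((\<lambda>z. N.psum (z - a)) has_derivative N.pderivative v) (at (a + v))"
    by (rule has_derivative_compose[of "\<lambda>z. z - a" "\<lambda>z. z" "a + v" UNIV N.psum "N.pderivative v"])
      (use N.has_derivative_psum[OF Cons.prems] in \<open>auto intro!: derivative_eq_intros\<close>)
  then have "((\<lambda>z. nth_fderiv F (length hs) z hs) has_derivative N.pderivative v) (at (a + v))"
  proof (rule has_derivative_transform_within_open)
    show "open (ball a R)" by simp
    show "a + v \<in> ball a R" using Cons.prems by (simp add: dist_norm)
    show "N.psum (z - a) = nth_fderiv F (length hs) z hs" if "z \<in> ball a R" for z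
      using Cons.IH[of "z - a"] that by (simp add: dist_norm norm_minus_commute)
  qed
  then have "fderiv (\<lambda>z. nth_fderiv F (length hs) z hs) (a + v) = N.pderivative v"
    using frechet_derivative_at by metis
  then show ?case by (simp add: N.psum_shift)
qed

text \<open>Identifies the unspecified coefficients of an analytic expansion with the scaled
  derivatives that enter \<open>gamma_number\<close>.\<close>

corollary nth_fderiv_center:
  assumes "\<And>v. norm v < R \<Longrightarrow> F (a + v) = psum v" and "0 < R" and "length hs = k"
  shows "nth_fderiv F k a hs = fact k *\<^sub>R B k hs"
proof -
  obtain c' where "normed_power_series (foldr shift_coeff hs B) c' R"
    using foldr_shift_power_series by blast
  then interpret N: normed_power_series "foldr shift_coeff hs B" c' R .
  have "nth_fderiv F k a hs = N.psum 0"
    using nth_fderiv_psum[of F a 0 hs] assms by simp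
  also have "\<dots> = fact k *\<^sub>R B k (rev hs)"
    using assms(3) by (simp add: N.psum_0 foldr_shift_coeff)
  also have "B k (rev hs) = B k hs"
    using assms(3) by (intro permute) auto
  finally show ?thesis .
qed

end

section \<open>Homogeneity and the norm of multilinear maps\<close>

text \<open>The index \<open>j\<close> counts the entries already rescaled. General \<open>c\<close>
  and \<open>f\<close> serve both the normalization of entries by \<open>sgn\<close> and the scaling
  of diagonal arguments.\<close>

lemma multilinear_factor_out:
  assumes "multilinear_map k A" and "length hs = k" and c: "\<And>x. x \<in> set hs \<Longrightarrow> x = c x *\<^sub>R f x"
    and "j \<le> k"
  shows "A hs = prod_list (map c (take j hs)) *\<^sub>R A (map f (take j hs) @ drop j hs)"
  using assms(4)
proof (induction j)
  case 0
  then show ?case by simp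
next
  case (Suc j)
  let ?g = "map f (take j hs) @ drop j hs"
  let ?h = "hs ! j"
  have j: "j < k" "length ?g = k" using Suc.prems assms(2) by auto
  have g: "?g[j := ?h] = ?g"
    using j assms(2) by (simp add: list_update_same_conv nth_append)
  have g': "?g[j := f ?h] = map f (take (Suc j) hs) @ drop (Suc j) hs"
    using j assms(2) by (simp add: list_update_append take_Suc_conv_app_nth Cons_nth_drop_Suc[symmetric])
  have h: "c ?h *\<^sub>R f ?h = ?h"
    using c[of ?h] j assms(2) by simp
  have "linear (\<lambda>v. A (?g[j := v]))"
    using assms(1) j unfolding multilinear_map_def by blast
  from linear_scale[OF this, of "c ?h" "f ?h"]
  have "A ?g = c ?h *\<^sub>R A (?g[j := f ?h])"
    by (simp only: h g)
  then show ?case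
    using Suc j assms(2) unfolding g' by (simp add: take_Suc_conv_app_nth)
qed

lemma multilinear_sgn:
  assumes "multilinear_map k A" and "length hs = k"
  shows "A hs = prod_list (map norm hs) *\<^sub>R A (map sgn hs)"
proof -
  have "x = norm x *\<^sub>R sgn x" for x :: 'a
    by (cases "x = 0") (simp_all add: sgn_div_norm)
  then show ?thesis
    using multilinear_factor_out[OF assms, of norm sgn k] assms(2) by simp
qed

lemma multilinear_replicate_scaleR:
  assumes "multilinear_map n A"
  shows "A (replicate n (s *\<^sub>R v)) = s ^ n *\<^sub>R A (replicate n v)"
  using multilinear_factor_out[OF assms, of "replicate n (s *\<^sub>R v)" "\<lambda>_. s" "\<lambda>_. v" n]
  by (simp add: prod_list_replicate)

lemma
  assumes "bounded_multilinear k A"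
  shows norm_le_multilinear_norm:
      "length hs = k \<Longrightarrow> norm (A hs) \<le> multilinear_norm k A * prod_list (map norm hs)"
    and multilinear_norm_nonneg: "0 \<le> multilinear_norm k A"
proof -
  let ?S = "{hs. length hs = k \<and> (\<forall>h\<in>set hs. norm h \<le> 1)}"
  obtain C where C: "\<And>hs. length hs = k \<Longrightarrow> norm (A hs) \<le> C * prod_list (map norm hs)"
    and ml: "multilinear_map k A"
    using assms unfolding bounded_multilinear_def by blast
  have p: "0 \<le> prod_list (map norm hs) \<and> prod_list (map norm hs) \<le> 1"
    if "\<forall>h\<in>set hs. norm h \<le> 1" for hs :: "'a list"
    using that by (induction hs) (auto intro: mult_le_one)
  \<comment> \<open>The sign of \<open>C\<close> is not known and the product of norms may be
    smaller than \<open>1\<close>, hence the absolute value.\<close>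
  have "norm (A hs) \<le> \<bar>C\<bar>" if "hs \<in> ?S" for hs
  proof -
    have "C * prod_list (map norm hs) \<le> \<bar>C\<bar> * 1"
      using that p[of hs] by (intro mult_mono) auto
    then show ?thesis using C[of hs] that by simp
  qed
  then have bdd: "bdd_above ((\<lambda>hs. norm (A hs)) ` ?S)"
    by (intro bdd_aboveI2) auto
  have le: "norm (A hs) \<le> multilinear_norm k A" if "hs \<in> ?S" for hs
    unfolding multilinear_norm_def using that bdd by (rule cSUP_upper)
  have "replicate k 0 \<in> ?S" by auto
  from le[OF this] show "0 \<le> multilinear_norm k A" using norm_ge_zero order_trans by blast
  show "norm (A hs) \<le> multilinear_norm k A * prod_list (map norm hs)" if "length hs = k"
  proof -
    have "map sgn hs \<in> ?S" using that by (auto simp: norm_sgn)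
    from le[OF this] have "prod_list (map norm hs) * norm (A (map sgn hs))
       \<le> prod_list (map norm hs) * multilinear_norm k A"
      by (intro mult_left_mono prod_list_norm_nonneg)
    moreover have "0 \<le> prod_list (map norm hs)" by (rule prod_list_norm_nonneg)
    ultimately show ?thesis
      using multilinear_sgn[OF ml that] by (simp add: mult.commute)
  qed
qed

lemma multilinear_norm_le:
  fixes A :: "'a::real_normed_vector list \<Rightarrow> 'b::real_normed_vector"
  assumes "\<And>hs. length hs = k \<Longrightarrow> norm (A hs) \<le> C * prod_list (map norm hs)" and "0 \<le> C"
  shows "multilinear_norm k A \<le> C"
  unfolding multilinear_norm_def
proof (rule cSUP_least)
  have "replicate k 0 \<in> {hs::'a list. length hs = k \<and> (\<forall>h\<in>set hs. norm h \<le> 1)}" by auto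
  then show "{hs::'a list. length hs = k \<and> (\<forall>h\<in>set hs. norm h \<le> 1)} \<noteq> {}" by blast
  fix hs :: "'a list" assume hs: "hs \<in> {hs. length hs = k \<and> (\<forall>h\<in>set hs. norm h \<le> 1)}"
  have "prod_list (map norm hs) \<le> 1" if "\<forall>h\<in>set hs. norm h \<le> 1" for hs :: "'a list"
    using that by (induction hs) (auto intro!: mult_le_one prod_list_norm_nonneg)
  then have "C * prod_list (map norm hs) \<le> C * 1"
    using hs assms(2) by (intro mult_left_mono) auto
  then show "norm (A hs) \<le> C" using assms(1)[of hs] hs by auto
qed

lemma multilinear_norm_cong:
  "(\<And>hs. length hs = k \<Longrightarrow> A hs = A' hs) \<Longrightarrow> multilinear_norm k A = multilinear_norm k A'"
  unfolding multilinear_norm_def by (rule SUP_cong) auto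

lemma bounded_multilinear_compose:
  assumes "bounded_linear L" and "bounded_multilinear k A"
  shows "bounded_multilinear k (\<lambda>hs. L (A hs))"
proof -
  obtain C where C: "\<And>hs. length hs = k \<Longrightarrow> norm (A hs) \<le> C * prod_list (map norm hs)"
    and ml: "multilinear_map k A"
    using assms unfolding bounded_multilinear_def by blast
  obtain K where K: "\<And>x. norm (L x) \<le> norm x * K" "0 < K"
    using bounded_linear.pos_bounded[OF assms(1)] by blast
  have "norm (L (A hs)) \<le> (C * K) * prod_list (map norm hs)" if "length hs = k" for hs
    using order_trans[OF K(1)[of "A hs"] mult_right_mono[OF C[OF that], of K]] K(2)
    by (simp add: mult_ac)
  moreover have "multilinear_map k (\<lambda>hs. L (A hs))"
    using ml linear_compose[OF _ bounded_linear.linear[OF assms(1)]]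
    unfolding multilinear_map_def o_def by blast
  ultimately show ?thesis unfolding bounded_multilinear_def by blast
qed

section \<open>Nonsingular operators and the normalized expansion at \<open>x0\<close>\<close>

lemma nonsingular_inv:
  assumes "nonsingular L"
  shows "bounded_linear L" "bounded_linear (inv L)" "inv L (L x) = x" "L (inv L y) = y"
  using assms by (auto simp: nonsingular_def bij_is_inj bij_is_surj surj_f_inv_f)

lemma nonsingular_compose:
  assumes "nonsingular A" and "nonsingular T"
  shows "nonsingular (\<lambda>x. A (T x))" and "inv (\<lambda>x. A (T x)) z = inv T (inv A z)"
proof -
  have bij: "bij (A \<circ> T)"
    using assms by (intro bij_comp) (auto simp: nonsingular_def)
  have inv: "inv (A \<circ> T) = inv T \<circ> inv A"
    using assms by (intro o_inv_distrib) (auto simp: nonsingular_def)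
  then show "inv (\<lambda>x. A (T x)) z = inv T (inv A z)" by (simp add: o_def fun_eq_iff)
  have "bounded_linear (A \<circ> T)" "bounded_linear (inv T \<circ> inv A)"
    using assms unfolding o_def by (auto simp: nonsingular_def intro: bounded_linear_compose)
  then have "nonsingular (A \<circ> T)"
    using bij inv by (simp add: nonsingular_def)
  then show "nonsingular (\<lambda>x. A (T x))" by (simp add: o_def)
qed

text \<open>The first coefficient is the identity, whose bound \<open>1\<close> is
  \<open>\<gamma> ^ 0\<close>; the higher ones are bounded because \<gamma> is their supremum of
  roots. These bounds alone give the radius \<open>1 / \<gamma>\<close>, while equality with
  \<open>F\<close> is so far known only within the radius \<rho> of the original expansion.\<close>

lemma smale_power_series:
  fixes F :: "'a::banach \<Rightarrow> 'b::banach"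
  assumes F: "analytic_operator_on F D" and "x0 \<in> D" and ns: "nonsingular (fderiv F x0)"
    and \<gamma>: "\<gamma> = gamma_number F x0" "0 < \<gamma>"
  obtains B \<rho>
  where "normed_power_series B
      (\<lambda>n. if n = 0 then norm (inv (fderiv F x0) (F x0)) else \<gamma> ^ (n - 1)) (1 / \<gamma>)"
    and "\<And>u. B 1 [u] = u" and "0 < \<rho>"
    and "\<And>v. norm v < \<rho> \<Longrightarrow> inv (fderiv F x0) (F (x0 + v)) = normed_power_series.psum B v"
proof -
  define L where "L = inv (fderiv F x0)"
  have L: "bounded_linear L" unfolding L_def by (rule nonsingular_inv[OF ns])
  obtain K where K: "\<And>x. norm (L x) \<le> norm x * K" "0 < K"
    using bounded_linear.pos_bounded[OF L] by blast
  obtain \<rho> A where \<rho>: "0 < \<rho>"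
    and A': "\<forall>n. bounded_multilinear n (A n) \<and> symmetric_map n (A n)"
    and sA: "summable (\<lambda>n. multilinear_norm n (A n) * \<rho> ^ n)"
    and FA': "\<forall>h. norm h < \<rho> \<longrightarrow> (\<lambda>n. A n (replicate n h)) sums F (x0 + h)"
    using bspec[OF F[unfolded analytic_operator_on_def] \<open>x0 \<in> D\<close>]
    by (elim exE conjE) (rule that)
  have A: "bounded_multilinear n (A n)" "symmetric_map n (A n)" for n
    using A' by auto
  have FA: "(\<lambda>n. A n (replicate n h)) sums F (x0 + h)" if "norm h < \<rho>" for h
    using FA' that by simp
  interpret A: normed_power_series A "\<lambda>n. multilinear_norm n (A n)" \<rho>
  proof
    show "multilinear_map n (A n)" for n using A(1) unfolding bounded_multilinear_def by blast
    show "summable (\<lambda>n. multilinear_norm n (A n) * x ^ n)" if "\<bar>x\<bar> < \<rho>" for x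
      using powser_inside[OF sA] that \<rho> by simp
  qed (use A in \<open>auto intro: norm_le_multilinear_norm multilinear_norm_nonneg\<close>)
  have F_psum: "F (x0 + h) = A.psum h" if "norm h < \<rho>" for h
    using FA[OF that] by (simp add: A.psum_def sums_iff)
  define B where "B n hs = L (A n hs)" for n hs
  have bB: "bounded_multilinear n (B n)" for n
    unfolding B_def by (rule bounded_multilinear_compose[OF L A(1)])
  define m where "m n = multilinear_norm n (B n)" for n
  have m0: "0 \<le> m n" for n unfolding m_def by (rule multilinear_norm_nonneg[OF bB])
  have Bm: "norm (B n hs) \<le> m n * prod_list (map norm hs)" if "length hs = n" for n hs
    unfolding m_def by (rule norm_le_multilinear_norm[OF bB that])
  have B1: "B 1 [u] = u" for u
  proof -
    have "nth_fderiv F 1 x0 [u] = fact 1 *\<^sub>R A 1 [u]"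
      by (rule A.nth_fderiv_center[OF F_psum \<rho>]) auto
    then show ?thesis using nonsingular_inv(3)[OF ns, of u] by (simp add: B_def L_def)
  qed
  have \<gamma>_m: "\<gamma> = (SUP k\<in>{k. k > 1}. root (k - 1) (m k))"
    unfolding \<gamma>(1) gamma_number_def m_def
  proof (intro SUP_cong refl arg_cong[where f = "root _"] multilinear_norm_cong)
    fix k and hs :: "'a list" assume "length hs = k"
    then show "inv (fderiv F x0) (nth_fderiv F k x0 hs) /\<^sub>R fact k = B k hs"
      using A.nth_fderiv_center[OF F_psum \<rho>, of hs k] linear_scale[OF bounded_linear.linear[OF L]]
      by (simp add: B_def flip: L_def)
  qed
  obtain M where M: "\<And>n. \<bar>multilinear_norm n (A n) * \<rho> ^ n\<bar> \<le> M"
    using summable_imp_Bseq[OF sA] unfolding Bseq_def by auto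
  \<comment> \<open>Since \<open>Q \<ge> 1\<close>, the constant \<open>K * M / \<rho>\<close> is at
    most \<open>Q ^ (k - 1)\<close> for every \<open>k > 1\<close>, so all roots are bounded by
    \<open>Q / \<rho>\<close>. A supremum in the reals carries information only once such a bound is
    known.\<close>
  define Q where "Q = max 1 (K * M / \<rho>)"
  have bdd: "bdd_above ((\<lambda>k. root (k - 1) (m k)) ` {k. k > 1})"
  proof (rule bdd_aboveI2)
    fix k :: nat assume "k \<in> {k. k > 1}"
    then have k: "0 < k - 1" "k = Suc (k - 1)" by auto
    have "multilinear_norm k (A k) * \<rho> ^ k \<le> M" using M[of k] by simp
    then have le: "multilinear_norm k (A k) \<le> M / \<rho> ^ k" using \<rho> by (simp add: field_simps)
    have "m k \<le> K * multilinear_norm k (A k)"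
      unfolding m_def
    proof (rule multilinear_norm_le)
      show "0 \<le> K * multilinear_norm k (A k)"
        using K(2) multilinear_norm_nonneg[OF A(1)] by simp
      show "norm (B k hs) \<le> K * multilinear_norm k (A k) * prod_list (map norm hs)"
        if "length hs = k" for hs
        using order_trans[OF K(1)[of "A k hs"] mult_right_mono[OF A.bound[OF that], of K]] K(2)
        by (simp add: B_def mult_ac)
    qed
    also have "\<dots> \<le> K * (M / \<rho> ^ k)" using le K(2) by (intro mult_left_mono) auto
    also have "\<dots> = (K * M / \<rho>) * (1 / \<rho>) ^ (k - 1)"
      by (subst k(2)) (simp add: power_divide)
    also have "\<dots> \<le> Q ^ (k - 1) * (1 / \<rho>) ^ (k - 1)"
    proof (rule mult_right_mono)
      have "K * M / \<rho> \<le> Q ^ 1" "1 \<le> Q" by (auto simp: Q_def)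
      then show "K * M / \<rho> \<le> Q ^ (k - 1)"
        using power_increasing[of 1 "k - 1" Q] k(1) by linarith
    qed (use \<rho> in simp)
    also have "\<dots> = (Q / \<rho>) ^ (k - 1)" by (simp add: power_divide)
    finally have "root (k - 1) (m k) \<le> root (k - 1) ((Q / \<rho>) ^ (k - 1))"
      using k(1) by simp
    also have "\<dots> = Q / \<rho>"
      using k(1) \<rho> by (intro real_root_power_cancel) (auto simp: Q_def)
    finally show "root (k - 1) (m k) \<le> Q / \<rho>" .
  qed
  have m_le: "m (Suc n) \<le> \<gamma> ^ n" if "n > 0" for n
  proof -
    have "root n (m (Suc n)) \<le> \<gamma>"
      using cSUP_upper[OF _ bdd, of "Suc n"] that unfolding \<gamma>_m by simp
    then have "root n (m (Suc n)) ^ n \<le> \<gamma> ^ n"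
      using that m0 by (intro power_mono real_root_ge_zero) auto
    then show ?thesis using real_root_pow_pos2[OF that m0] by simp
  qed
  define c where "c n = (if n = 0 then norm (L (F x0)) else \<gamma> ^ (n - 1))" for n
  interpret B: normed_power_series B c "1 / \<gamma>"
  proof
    show "multilinear_map n (B n)" for n using bB unfolding bounded_multilinear_def by blast
    show "symmetric_map n (B n)" for n
      using A(2)[of n] unfolding symmetric_map_def B_def by metis
    show "0 \<le> c n" for n using \<gamma> by (simp add: c_def)
    show "norm (B n hs) \<le> c n * prod_list (map norm hs)" if len: "length hs = n" for n hs
    proof -
      consider "n = 0" | "n = 1" | k where "n = Suc k" "k > 0" by (metis One_nat_def not0_implies_Suc neq0_conv)
      then show ?thesis
      proof cases
        case 1
        then show ?thesis using len F_psum[of 0] \<rho> by (simp add: c_def B_def A.psum_0)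
      next
        case 2
        then obtain u where "hs = [u]" using len by (metis One_nat_def length_0_conv length_Suc_conv)
        then show ?thesis using B1[of u] 2 by (simp add: c_def)
      next
        case 3
        have "m n * prod_list (map norm hs) \<le> c n * prod_list (map norm hs)"
          using m_le[OF 3(2)] 3 by (intro mult_right_mono) (auto simp: c_def prod_list_norm_nonneg)
        then show ?thesis using Bm[OF len] by linarith
      qed
    qed
    show "summable (\<lambda>n. c n * x ^ n)" if "\<bar>x\<bar> < 1 / \<gamma>" for x
    proof -
      have "\<bar>\<gamma> * x\<bar> < 1" using that \<gamma>(2) by (simp add: abs_mult field_simps)
      then have "summable (\<lambda>n. x * (\<gamma> * x) ^ n)"
        by (intro summable_mult summable_geometric) simp
      then have "summable (\<lambda>n. c (Suc n) * x ^ Suc n)"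
        by (simp add: c_def power_mult_distrib mult_ac)
      then show ?thesis by (subst (asm) summable_Suc_iff)
    qed
  qed
  show ?thesis
  proof
    show "normed_power_series B
      (\<lambda>n. if n = 0 then norm (inv (fderiv F x0) (F x0)) else \<gamma> ^ (n - 1)) (1 / \<gamma>)"
      using B.normed_power_series_axioms unfolding c_def L_def .
    show "inv (fderiv F x0) (F (x0 + v)) = B.psum v" if "norm v < \<rho>" for v
      using bounded_linear.sums[OF L FA[OF that]]
      by (simp add: B.psum_def B_def sums_iff L_def)
  qed (use B1 \<rho> in auto)
qed

section \<open>Analytic continuation along segments\<close>

definition locally_power_series :: "(real \<Rightarrow> 'b::real_normed_vector) \<Rightarrow> real \<Rightarrow> bool" where
  "locally_power_series f t \<longleftrightarrow>
     (\<exists>r>0. \<exists>a. \<forall>s. \<bar>s\<bar> < r \<longrightarrow> (\<lambda>n. s ^ n *\<^sub>R a n) sums f (t + s))"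

lemma locally_power_series_diff:
  assumes "locally_power_series f t" and "locally_power_series g t"
  shows "locally_power_series (\<lambda>x. f x - g x) t"
proof -
  obtain r a where r: "0 < r" "\<And>s. \<bar>s\<bar> < r \<Longrightarrow> (\<lambda>n. s ^ n *\<^sub>R a n) sums f (t + s)"
    using assms(1) unfolding locally_power_series_def by blast
  obtain r' b where r': "0 < r'" "\<And>s. \<bar>s\<bar> < r' \<Longrightarrow> (\<lambda>n. s ^ n *\<^sub>R b n) sums g (t + s)"
    using assms(2) unfolding locally_power_series_def by blast
  have "(\<lambda>n. s ^ n *\<^sub>R (a n - b n)) sums (f (t + s) - g (t + s))" if "\<bar>s\<bar> < min r r'" for s
    using sums_diff[OF r(2) r'(2), of s s] that by (simp add: scaleR_diff_right)
  then show ?thesis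
    unfolding locally_power_series_def using r(1) r'(1)
    by (intro exI[of _ "min r r'"] conjI exI[of _ "\<lambda>n. a n - b n"]) auto
qed

text \<open>Vanishing on the left is all that the continuation argument supplies. Once the lower
  coefficients are gone, division by \<open>s ^ n\<close> leaves \<open>a n\<close> plus a tail of
  size at most a constant times \<open>- s\<close>, and \<open>s\<close> tends to 0.\<close>

lemma power_series_zero_left_imp_coeff_zero:
  fixes a :: "nat \<Rightarrow> 'b::banach"
  assumes "0 < r" and z: "\<And>s. -r < s \<Longrightarrow> s < 0 \<Longrightarrow> (\<lambda>n. s ^ n *\<^sub>R a n) sums 0"
  shows "a n = 0"
proof (induction n rule: less_induct)
  case (less n)
  \<comment> \<open>Convergence at the single point \<open>- r / 2\<close> bounds all coefficients
    geometrically.\<close>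
  have "summable (\<lambda>n. (- r / 2) ^ n *\<^sub>R a n)"
    using z[of "- r / 2"] assms(1) by (auto simp: sums_iff)
  from summable_imp_Bseq[OF this] obtain K
    where K: "0 < K" "\<And>n. norm ((- r / 2) ^ n *\<^sub>R a n) \<le> K"
    unfolding Bseq_def by auto
  have aK: "norm (a j) \<le> K * (2 / r) ^ j" for j
    using K(2)[of j] assms(1) by (simp add: power_abs field_simps)
  \<comment> \<open>For \<open>- r / 4 < s\<close> the tail bounds shrink by at least
    \<open>1 / 2\<close> per term; the geometric sum is the factor \<open>2\<close>.\<close>
  define M where "M = 2 * (K * (2 / r) ^ Suc n)"
  have M0: "0 < M" using K(1) assms(1) by (simp add: M_def)
  have small: "norm (a n) \<le> - s * M" if s: "- r / 4 < s" "s < 0" for s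
  proof -
    have "(\<lambda>j. s ^ (j + n) *\<^sub>R a (j + n)) sums (0 - (\<Sum>i<n. s ^ i *\<^sub>R a i))"
      using sums_split_initial_segment[OF z[of s]] s assms(1) by simp
    then have "(\<lambda>j. s ^ (j + n) *\<^sub>R a (j + n)) sums 0"
      using less.IH by simp
    from sums_scaleR_right[OF this, of "inverse (s ^ n)"]
    have "(\<lambda>j. s ^ j *\<^sub>R a (j + n)) sums 0"
      using s by (simp add: power_add mult.left_commute[of _ "s ^ _" "s ^ n"])
    then have "(\<lambda>j. s ^ Suc j *\<^sub>R a (Suc j + n)) sums (0 - a n)"
      by (subst sums_Suc_iff) simp
    moreover have "norm (s ^ Suc j *\<^sub>R a (Suc j + n)) \<le> - s * (K * (2 / r) ^ Suc n) * (1 / 2) ^ j" for j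
    proof -
      have "norm (s ^ Suc j *\<^sub>R a (Suc j + n)) \<le> \<bar>s\<bar> ^ Suc j * (K * (2 / r) ^ (Suc j + n))"
        using mult_left_mono[OF aK[of "Suc j + n"], of "\<bar>s\<bar> ^ Suc j"] by (simp add: power_abs abs_mult)
      also have "\<dots> = - s * (K * (2 / r) ^ Suc n) * (\<bar>s\<bar> * 2 / r) ^ j"
      proof -
        have "x ^ Suc j * (K * (2 / r) ^ (Suc j + n)) = x * (K * (2 / r) ^ Suc n) * (x * 2 / r) ^ j" for x
          by (simp add: power_add power_mult_distrib power_divide mult_ac)
        from this[of "\<bar>s\<bar>"] show ?thesis using s(2) by (simp only: abs_of_neg)
      qed
      also have "\<dots> \<le> - s * (K * (2 / r) ^ Suc n) * (1 / 2) ^ j"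
      proof (rule mult_left_mono)
        show "(\<bar>s\<bar> * 2 / r) ^ j \<le> (1 / 2) ^ j"
          using s assms(1) by (intro power_mono) (auto simp: field_simps)
        show "0 \<le> - s * (K * (2 / r) ^ Suc n)"
          using s assms(1) K(1) by (intro mult_nonneg_nonneg) auto
      qed
      finally show ?thesis .
    qed
    moreover have "(\<lambda>j. - s * (K * (2 / r) ^ Suc n) * (1 / 2) ^ j) sums
        (- s * (K * (2 / r) ^ Suc n) * (1 / (1 - 1 / 2)))"
      by (intro sums_mult geometric_sums) simp
    ultimately have "norm (0 - a n) \<le> - s * (K * (2 / r) ^ Suc n) * (1 / (1 - 1 / 2))"
      using norm_sums_le_sums by blast
    then show ?thesis by (simp add: M_def mult_ac)
  qed
  have "norm (a n) \<le> 0 + e" if "0 < e" for e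
  proof -
    \<comment> \<open>\<open>r / 8\<close> keeps \<open>s\<close> in the range of
      \<open>small\<close>, and \<open>e / M\<close> makes the bound there at most
      \<open>e\<close>.\<close>
    define s where "s = - min (r / 8) (e / M)"
    have "0 < e / M" using that M0 by simp
    then have "- r / 4 < s" "s < 0" and le: "- s \<le> e / M"
      using assms(1) unfolding s_def by linarith+
    then have "norm (a n) \<le> - s * M" using small by blast
    also have "\<dots> \<le> e / M * M" using le M0 by (intro mult_right_mono) auto
    finally show ?thesis using M0 by simp
  qed
  then have "norm (a n) \<le> 0" by (rule field_le_epsilon)
  then show ?case by simp
qed

text \<open>At the supremum \<open>T\<close> of the times before which \<open>f\<close> vanishes,
  the one-sided lemma kills all coefficients, so \<open>f\<close> vanishes beyond \<open>T\<close>
  as well and \<open>T\<close> must be 1. Members of \<open>S\<close> make no claim at their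
  endpoint; the value at 1 comes from the expansion there.\<close>

lemma locally_power_series_identity:
  fixes f :: "real \<Rightarrow> 'b::banach"
  assumes f: "\<And>t. 0 \<le> t \<Longrightarrow> t \<le> 1 \<Longrightarrow> locally_power_series f t"
    and "0 < e" and "\<And>t. 0 \<le> t \<Longrightarrow> t < e \<Longrightarrow> f t = 0"
  shows "f 1 = 0"
proof -
  define S where "S = {t. 0 < t \<and> t \<le> 1 \<and> (\<forall>s. 0 \<le> s \<and> s < t \<longrightarrow> f s = 0)}"
  define T where "T = Sup S"
  have e: "min e 1 \<in> S" using assms(2,3) unfolding S_def by simp
  have bdd: "bdd_above S" by (rule bdd_aboveI[of _ 1]) (auto simp: S_def)
  have T0: "0 < T" using cSup_upper[OF e bdd] assms(2) by (auto simp: T_def)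
  have T1: "T \<le> 1" unfolding T_def
  proof (rule cSup_least)
    show "S \<noteq> {}" using e by blast
  qed (simp add: S_def)
  have below: "f s = 0" if s: "0 \<le> s" "s < T" for s
  proof -
    obtain t where "t \<in> S" "s < t"
      using less_cSupD[of S s] e s(2) by (auto simp: T_def)
    then show ?thesis using s(1) by (auto simp: S_def)
  qed
  obtain r a where r: "0 < r" "\<And>s. \<bar>s\<bar> < r \<Longrightarrow> (\<lambda>n. s ^ n *\<^sub>R a n) sums f (T + s)"
    using f[of T] T0 T1 unfolding locally_power_series_def by auto
  have "a n = 0" for n
  proof (rule power_series_zero_left_imp_coeff_zero[of "min r T"])
    fix s assume "- min r T < s" "s < 0"
    then show "(\<lambda>n. s ^ n *\<^sub>R a n) sums 0"
      using r(2)[of s] below[of "T + s"] by simp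
  qed (use r T0 in simp)
  then have zero: "f (T + s) = 0" if "\<bar>s\<bar> < r" for s
    using sums_unique2[OF r(2)[OF that], of 0] by simp
  have "T = 1"
  proof (rule ccontr)
    assume "T \<noteq> 1"
    then have "T < 1" using T1 by simp
    have "f s = 0" if "0 \<le> s" "s < min (T + r) 1" for s
      using below[of s] zero[of "s - T"] that by (cases "s < T") auto
    then have "min (T + r) 1 \<in> S" using T0 r(1) by (auto simp: S_def)
    then have "min (T + r) 1 \<le> T" unfolding T_def using bdd by (rule cSup_upper)
    then show False using r(1) \<open>T < 1\<close> by simp
  qed
  then show ?thesis using zero[of 0] r(1) by simp
qed

text \<open>Recentring: expand \<open>(t + s) ^ n\<close> by the binomial theorem and sum the double
  series by columns. The rows of norms sum to
  \<open>(\<bar>s\<bar> + \<bar>t\<bar>) ^ n * norm (b n)\<close>, which permits the exchange and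
  dictates the new radius \<open>\<rho> - \<bar>t\<bar>\<close>.\<close>

lemma locally_power_series_powser:
  fixes b :: "nat \<Rightarrow> 'b::banach"
  assumes sb: "summable (\<lambda>n. norm (b n) * \<rho> ^ n)" and t: "\<bar>t\<bar> < \<rho>"
  shows "locally_power_series (\<lambda>x. \<Sum>n. x ^ n *\<^sub>R b n) t"
proof -
  define a where "a k = infsum (\<lambda>n. (real (n choose k) * t ^ (n - k)) *\<^sub>R b n) UNIV" for k
  have "(\<lambda>k. s ^ k *\<^sub>R a k) sums (\<Sum>n. (t + s) ^ n *\<^sub>R b n)" if s: "\<bar>s\<bar> < \<rho> - \<bar>t\<bar>" for s
  proof -
    define f where "f n k = (real (n choose k) * t ^ (n - k) * s ^ k) *\<^sub>R b n" for n k
    have sn: "summable (\<lambda>n. (\<bar>s\<bar> + \<bar>t\<bar>) ^ n * norm (b n))"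
    proof -
      have "norm (\<bar>s\<bar> + \<bar>t\<bar>) < norm \<rho>" using s by simp
      from powser_inside[OF sb this] show ?thesis by (simp add: mult.commute)
    qed
    have row: "((\<lambda>k. norm (f n k)) has_sum (\<bar>s\<bar> + \<bar>t\<bar>) ^ n * norm (b n)) UNIV" for n
    proof (rule has_sum_finite_neutralI[of "{..n}"])
      show "(\<bar>s\<bar> + \<bar>t\<bar>) ^ n * norm (b n) = (\<Sum>k\<le>n. norm (f n k))"
        by (simp add: f_def binomial_ring sum_distrib_right abs_mult power_abs mult_ac sum_distrib_left)
    qed (auto simp: f_def binomial_eq_0)
    have row': "(f n has_sum (t + s) ^ n *\<^sub>R b n) UNIV" for n
    proof (rule has_sum_finite_neutralI[of "{..n}"])
      show "(t + s) ^ n *\<^sub>R b n = (\<Sum>k\<le>n. f n k)"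
        by (simp add: f_def binomial_ring scaleR_sum_left add.commute[of t] mult_ac)
    qed (auto simp: f_def binomial_eq_0)
    have abs_sf: "(\<lambda>x. norm (case x of (n, k) \<Rightarrow> f n k)) summable_on (UNIV \<times> UNIV)"
    proof (rule iffD2[OF Infinite_Sum.abs_summable_on_Sigma_iff], intro conjI ballI)
      show "(\<lambda>k. norm (case (n, k) of (n, k) \<Rightarrow> f n k)) summable_on UNIV" for n
        using row[of n] by (auto simp: summable_on_def)
      have "infsum (\<lambda>k. norm (f n k)) UNIV = (\<bar>s\<bar> + \<bar>t\<bar>) ^ n * norm (b n)" for n
        using row by (rule infsumI)
      then show "(\<lambda>n. norm (\<Sum>\<^sub>\<infinity>k\<in>UNIV. norm (case (n, k) of (n, k) \<Rightarrow> f n k))) summable_on UNIV"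
        using sn by (simp add: summable_on_UNIV_nonneg_real_iff)
    qed
    from abs_sf have sf: "(\<lambda>(n, k). f n k) summable_on (UNIV \<times> UNIV)"
      by (rule abs_summable_summable)
    have "norm ((t + s) ^ n *\<^sub>R b n) \<le> (\<bar>s\<bar> + \<bar>t\<bar>) ^ n * norm (b n)" for n
    proof -
      have "\<bar>t + s\<bar> ^ n \<le> (\<bar>s\<bar> + \<bar>t\<bar>) ^ n"
        by (rule power_mono) auto
      then show ?thesis by (simp add: power_abs mult_right_mono)
    qed
    then have sts: "summable (\<lambda>n. norm ((t + s) ^ n *\<^sub>R b n))"
      by (intro summable_comparison_test'[OF sn]) auto
    have "((\<lambda>n. (t + s) ^ n *\<^sub>R b n) has_sum (\<Sum>n. (t + s) ^ n *\<^sub>R b n)) UNIV"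
      by (rule norm_summable_imp_has_sum[OF sts summable_sums[OF summable_norm_cancel[OF sts]]])
    then have double: "((\<lambda>(n, k). f n k) has_sum (\<Sum>n. (t + s) ^ n *\<^sub>R b n)) (UNIV \<times> UNIV)"
      by (intro has_sum_SigmaI[OF _ _ sf]) (use row' in auto)
    have swapped: "((\<lambda>(k, n). f n k) has_sum (\<Sum>n. (t + s) ^ n *\<^sub>R b n)) (UNIV \<times> UNIV)"
      using iffD1[OF has_sum_swap double] by (simp only: prod.case)
    have "((\<lambda>n. f n k) has_sum s ^ k *\<^sub>R a k) UNIV" for k
    proof -
      have "(\<lambda>x. norm (case x of (k, n) \<Rightarrow> f n k)) summable_on (UNIV \<times> UNIV)"
        using iffD1[OF summable_on_swap abs_sf] by (simp add: case_prod_unfold)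
      then have "\<forall>k\<in>UNIV. (\<lambda>n. norm (case (k, n) of (k, n) \<Rightarrow> f n k)) summable_on UNIV"
        unfolding Infinite_Sum.abs_summable_on_Sigma_iff[of "\<lambda>(k, n). f n k" UNIV "\<lambda>_. UNIV"]
        by (rule conjunct1)
      then have "(\<lambda>n. f n k) summable_on UNIV"
        using abs_summable_summable[of "\<lambda>n. f n k" UNIV] by simp
      moreover have "infsum (\<lambda>n. f n k) UNIV = s ^ k *\<^sub>R a k"
        unfolding a_def f_def by (subst infsum_scaleR_right[symmetric]) (simp add: mult_ac)
      ultimately show ?thesis using has_sum_infsum by metis
    qed
    then have "((\<lambda>k. s ^ k *\<^sub>R a k) has_sum (\<Sum>n. (t + s) ^ n *\<^sub>R b n)) UNIV"
      by (intro has_sum_SigmaD[OF swapped]) auto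
    then show ?thesis by (rule has_sum_imp_sums)
  qed
  then show ?thesis
    unfolding locally_power_series_def using t
    by (intro exI[of _ "\<rho> - \<bar>t\<bar>"] conjI exI[of _ a]) auto
qed

text \<open>
  Analytic continuation along the segment from \<open>x0\<close> to \<open>x0 + v\<close>: only real-analyticity in one real
  parameter is needed, and the segment stays in the convex set \<open>D\<close>.
\<close>

lemma (in normed_power_series) analytic_eq_psum:
  assumes F: "analytic_operator_on F D" and "convex D" and L: "bounded_linear L"
    and local: "0 < \<rho>" "\<And>h. norm h < \<rho> \<Longrightarrow> L (F (x0 + h)) = psum h"
    and D: "x0 \<in> D" "x0 + v \<in> D" and v: "norm v < R"
  shows "L (F (x0 + v)) = psum v"
proof (cases "v = 0")
  case True
  then show ?thesis using local(1) local(2)[of 0] by simp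
next
  case False
  then have v0: "0 < norm v" by simp
  define b where "b n = B n (replicate n v)" for n
  have psum_b: "psum (t *\<^sub>R v) = (\<Sum>n. t ^ n *\<^sub>R b n)" for t
    unfolding psum_def b_def by (simp add: multilinear_replicate_scaleR[OF multilinear])
  \<comment> \<open>\<open>q * norm v\<close> is the midpoint of \<open>norm v\<close> and
    \<open>R\<close>. Thus \<open>q > 1\<close>, and the series in \<open>t\<close> can be recentred
    even at the endpoint 1.\<close>
  define q where "q = (norm v + R) / (2 * norm v)"
  have q: "1 < q" "q * norm v < R" using v v0 by (auto simp: q_def field_simps)
  have "summable (\<lambda>n. c n * (q * norm v) ^ n)"
    using q v0 by (intro summable_c) (simp add: abs_mult)
  then have "summable (\<lambda>n. norm (b n) * q ^ n)"
  proof (rule summable_comparison_test')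
    fix n
    have "norm (b n) \<le> c n * norm v ^ n"
      using bound[of "replicate n v" n] by (simp add: b_def prod_list_replicate)
    then have "norm (b n) * q ^ n \<le> c n * norm v ^ n * q ^ n"
      using q by (intro mult_right_mono) auto
    then show "norm (norm (b n) * q ^ n) \<le> c n * (q * norm v) ^ n"
      using q by (simp add: power_mult_distrib mult_ac)
  qed
  then have p: "locally_power_series (\<lambda>t. psum (t *\<^sub>R v)) t" if "\<bar>t\<bar> \<le> 1" for t
    unfolding psum_b using that q by (intro locally_power_series_powser) auto
  have f: "locally_power_series (\<lambda>t. L (F (x0 + t *\<^sub>R v))) t" if t: "0 \<le> t" "t \<le> 1" for t
  proof -
    have "x0 + t *\<^sub>R v = (1 - t) *\<^sub>R x0 + t *\<^sub>R (x0 + v)" by (simp add: algebra_simps)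
    then have "x0 + t *\<^sub>R v \<in> D"
      using convexD_alt[OF \<open>convex D\<close> D] t by simp
    from bspec[OF F[unfolded analytic_operator_on_def] this] obtain r A where
      r: "0 < r" and A: "\<forall>n. bounded_multilinear n (A n) \<and> symmetric_map n (A n)"
      and s: "\<forall>h. norm h < r \<longrightarrow> (\<lambda>n. A n (replicate n h)) sums F (x0 + t *\<^sub>R v + h)"
      by (elim exE conjE) (rule that)
    have ml: "multilinear_map n (A n)" for n
      using A unfolding bounded_multilinear_def by blast
    have "(\<lambda>n. s ^ n *\<^sub>R L (A n (replicate n v))) sums L (F (x0 + (t + s) *\<^sub>R v))"
      if "\<bar>s\<bar> < r / norm v" for s
    proof -
      have "norm (s *\<^sub>R v) < r" using that v0 by (simp add: field_simps)
      with s have "(\<lambda>n. A n (replicate n (s *\<^sub>R v))) sums F (x0 + t *\<^sub>R v + s *\<^sub>R v)" by blast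
      from bounded_linear.sums[OF L this] show ?thesis
        by (simp add: multilinear_replicate_scaleR[OF ml] linear_scale[OF bounded_linear.linear[OF L]]
            scaleR_add_left add.assoc)
    qed
    then show ?thesis
      unfolding locally_power_series_def using r v0
      by (intro exI[of _ "r / norm v"] conjI exI[of _ "\<lambda>n. L (A n (replicate n v))"]) auto
  qed
  have "L (F (x0 + 1 *\<^sub>R v)) - psum (1 *\<^sub>R v) = 0"
  proof (rule locally_power_series_identity)
    show "0 < \<rho> / norm v" using local v0 by simp
    show "L (F (x0 + t *\<^sub>R v)) - psum (t *\<^sub>R v) = 0" if "0 \<le> t" "t < \<rho> / norm v" for t
      using local(2)[of "t *\<^sub>R v"] that v0 by (simp add: field_simps)
    show "locally_power_series (\<lambda>t. L (F (x0 + t *\<^sub>R v)) - psum (t *\<^sub>R v)) t"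
      if "0 \<le> t" "t \<le> 1" for t
      using that by (intro locally_power_series_diff f p) auto
  qed
  then show ?thesis by simp
qed

section \<open>The majorant function\<close>

text \<open>Closed form of \<beta> - t plus the sum of \<open>\<gamma> ^ (k - 1) * t ^ k\<close>
  over k >= 2: the coefficient bounds of the normalized operator, with the linear one taken
  negative.\<close>

definition majorant :: "real \<Rightarrow> real \<Rightarrow> real \<Rightarrow> real" where
  "majorant \<beta> \<gamma> t = \<beta> - t + \<gamma> * t\<^sup>2 / (1 - \<gamma> * t)"

text \<open>The derivative of the majorant, in which \<beta> drops out. For
  \<open>\<bar>\<gamma> * t\<bar> < 1\<close>, adding 1 gives the sum of
  \<open>(1 + real n) * (\<gamma> * t) ^ n\<close> over n >= 1, which bounds the distance of the
  operator's derivative from the identity.\<close>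

definition dmajorant :: "real \<Rightarrow> real \<Rightarrow> real" where
  "dmajorant \<gamma> t = 1 / (1 - \<gamma> * t)\<^sup>2 - 2"

section \<open>Perturbation of the identity and a mean value inequality\<close>

text \<open>A solution of \<open>T x = y\<close> is a fixed point of the contraction sending
  \<open>u\<close> to \<open>y - (T u - u)\<close>. The lower bound \<open>(1 - q) * norm u\<close>
  gives injectivity and the bound on the inverse together.\<close>

lemma nonsingular_near_id:
  fixes T :: "'a::banach \<Rightarrow> 'a"
  assumes T: "bounded_linear T" and q: "0 \<le> q" "q < 1"
    and near: "\<And>u. norm (T u - u) \<le> q * norm u"
  shows "nonsingular T" and "norm (inv T v) \<le> norm v / (1 - q)"
proof -
  interpret T: bounded_linear T by fact
  have lower: "(1 - q) * norm u \<le> norm (T u)" for u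
    using near[of u] norm_triangle_ineq2[of u "T u"]
    by (simp add: norm_minus_commute algebra_simps)
  have "inj T"
  proof (rule injI)
    fix x y assume "T x = T y"
    then have "(1 - q) * norm (x - y) \<le> 0" using lower[of "x - y"] by (simp add: T.diff)
    then show "x = y" using q by (simp add: mult_le_0_iff)
  qed
  moreover have "surj T"
    unfolding surj_def
  proof
    fix y
    have "\<forall>u v. dist (y - (T u - u)) (y - (T v - v)) \<le> q * dist u v"
    proof (intro allI)
      fix u v
      have "y - (T u - u) - (y - (T v - v)) = - (T (u - v) - (u - v))"
        by (simp add: T.diff)
      then show "dist (y - (T u - u)) (y - (T v - v)) \<le> q * dist u v"
        using near[of "u - v"] unfolding dist_norm by (metis norm_minus_cancel)
    qed
    from banach_fix_type[OF q this] obtain x where "y - (T x - x) = x" by blast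
    then have "y = T x" by (simp add: algebra_simps)
    then show "\<exists>x. y = T x" ..
  qed
  ultimately have bij: "bij T" by (simp add: bij_def)
  have inv: "norm (inv T v) \<le> norm v / (1 - q)" for v
    using lower[of "inv T v"] q bij by (simp add: bij_is_surj surj_f_inv_f field_simps)
  then show "norm (inv T v) \<le> norm v / (1 - q)" .
  have Tinv: "T (inv T v) = v" for v using bij by (simp add: bij_is_surj surj_f_inv_f)
  have eqI: "inv T v = u" if "T u = v" for u v using bij that by (metis bij_inv_eq_iff)
  have "bounded_linear (inv T)"
  proof (rule bounded_linear_intro)
    show "inv T (x + y) = inv T x + inv T y" for x y by (rule eqI) (simp add: T.add Tinv)
    show "inv T (r *\<^sub>R x) = r *\<^sub>R inv T x" for r x by (rule eqI) (simp add: T.scaleR Tinv)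
    show "norm (inv T x) \<le> norm x * (1 / (1 - q))" for x using inv[of x] by simp
  qed
  then show "nonsingular T" using T bij by (simp add: nonsingular_def)
qed

text \<open>The increment of a scalar function replaces an integral. The free vector
  \<open>a\<close> admits linearizations whose derivative is frozen at a point other than
  \<open>p\<close>.\<close>

lemma has_derivative_segment_bound:
  fixes G :: "'a::real_normed_vector \<Rightarrow> 'b::real_normed_vector"
  assumes U: "convex U" "p \<in> U" "q \<in> U"
    and deriv: "\<And>x. x \<in> U \<Longrightarrow> (G has_derivative G' x) (at x)"
    and \<phi>: "\<And>\<tau>. 0 \<le> \<tau> \<Longrightarrow> \<tau> \<le> 1 \<Longrightarrow> (\<phi> has_real_derivative \<phi>' \<tau>) (at \<tau>)"
    and le: "\<And>\<tau>. 0 \<le> \<tau> \<Longrightarrow> \<tau> \<le> 1 \<Longrightarrow> p + \<tau> *\<^sub>R (q - p) \<in> U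
      \<Longrightarrow> norm (G' (p + \<tau> *\<^sub>R (q - p)) (q - p) - a) \<le> \<phi>' \<tau>"
  shows "norm (G q - G p - a) \<le> \<phi> 1 - \<phi> 0"
proof -
  have in_U: "p + \<tau> *\<^sub>R (q - p) \<in> U" if "0 \<le> \<tau>" "\<tau> \<le> 1" for \<tau>
    using convexD_alt[OF U that] by (simp add: algebra_simps)
  define f where "f \<tau> = G (p + \<tau> *\<^sub>R (q - p)) - \<tau> *\<^sub>R a" for \<tau>
  have f: "(f has_vector_derivative G' (p + \<tau> *\<^sub>R (q - p)) (q - p) - a) (at \<tau>)"
    if "0 \<le> \<tau>" "\<tau> \<le> 1" for \<tau>
  proof -
    have lin: "linear (G' (p + \<tau> *\<^sub>R (q - p)))"
      using deriv[OF in_U[OF that]] has_derivative_linear by blast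
    have "((\<lambda>\<tau>. p + \<tau> *\<^sub>R (q - p)) has_derivative (\<lambda>s. s *\<^sub>R (q - p))) (at \<tau>)"
      by (auto intro!: derivative_eq_intros)
    from has_derivative_compose[OF this deriv[OF in_U[OF that]]]
    have "((\<lambda>\<tau>. G (p + \<tau> *\<^sub>R (q - p))) has_vector_derivative G' (p + \<tau> *\<^sub>R (q - p)) (q - p)) (at \<tau>)"
      by (simp add: has_vector_derivative_def linear_scale[OF lin])
    then show ?thesis
      unfolding f_def by (auto intro!: derivative_eq_intros)
  qed
  have "norm (f 1 - f 0) \<le> \<phi> 1 - \<phi> 0"
  proof (rule differentiable_bound_general)
    show "continuous_on {0..1} f"
      using f by (auto intro!: continuous_at_imp_continuous_on has_vector_derivative_continuous)
    show "continuous_on {0..1} \<phi>"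
      using \<phi> by (auto intro!: continuous_at_imp_continuous_on DERIV_isCont)
    show "(f has_vector_derivative G' (p + \<tau> *\<^sub>R (q - p)) (q - p) - a) (at \<tau>)"
      if "0 < \<tau>" "\<tau> < 1" for \<tau> using f that by auto
    show "(\<phi> has_vector_derivative \<phi>' \<tau>) (at \<tau>)" if "0 < \<tau>" "\<tau> < 1" for \<tau>
      using \<phi>[of \<tau>] that by (simp add: has_real_derivative_iff_has_vector_derivative)
    show "norm (G' (p + \<tau> *\<^sub>R (q - p)) (q - p) - a) \<le> \<phi>' \<tau>" if "0 < \<tau>" "\<tau> < 1" for \<tau>
      using le in_U that by auto
  qed simp
  then show ?thesis by (simp add: f_def algebra_simps)
qed

section \<open>Scalar analysis of the majorant\<close>

locale smale_majorant =
  fixes \<beta> \<gamma> \<alpha> S tstar tsstar r0 :: real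
  assumes \<beta>_pos: "0 < \<beta>" and \<gamma>_pos: "0 < \<gamma>"
    and \<alpha>_def: "\<alpha> = \<beta> * \<gamma>" and \<alpha>_le: "\<alpha> \<le> 3 - 2 * sqrt 2"
    and S_def: "S = sqrt ((1 + \<alpha>)\<^sup>2 - 8 * \<alpha>)"
    and tstar_def: "tstar = (1 + \<alpha> - S) / (4 * \<gamma>)"
    and tsstar_def: "tsstar = (1 + \<alpha> + S) / (4 * \<gamma>)"
    and r0_def: "r0 = (1 - 1 / sqrt 2) * (1 / \<gamma>)"
begin

abbreviation "h \<equiv> majorant \<beta> \<gamma>"
abbreviation "dh \<equiv> dmajorant \<gamma>"

lemma \<alpha>_pos: "0 < \<alpha>" unfolding \<alpha>_def using \<beta>_pos \<gamma>_pos by simp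

text \<open>This is the discriminant of the numerator of \<open>h\<close>;
  \<open>3 - 2 * sqrt 2\<close> is where the two zeros merge.\<close>

lemma discriminant: "(1 + \<alpha>)\<^sup>2 - 8 * \<alpha> = (3 - 2 * sqrt 2 - \<alpha>) * (3 + 2 * sqrt 2 - \<alpha>)"
  by (simp add: power2_eq_square algebra_simps)

lemma S_nonneg: "0 \<le> S" and S_sq: "S\<^sup>2 = (1 + \<alpha>)\<^sup>2 - 8 * \<alpha>"
proof -
  have "0 \<le> 3 + 2 * sqrt 2 - \<alpha>" using \<alpha>_le by (smt (verit) real_sqrt_ge_zero)
  then have "0 \<le> (1 + \<alpha>)\<^sup>2 - 8 * \<alpha>"
    unfolding discriminant using \<alpha>_le by (intro mult_nonneg_nonneg) auto
  then show "0 \<le> S" "S\<^sup>2 = (1 + \<alpha>)\<^sup>2 - 8 * \<alpha>" by (simp_all add: S_def)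
qed

lemma \<alpha>_lt: "\<alpha> < 1"
proof -
  have "1 < sqrt 2" by simp
  then show ?thesis using \<alpha>_le by linarith
qed

text \<open>Holds since \<open>S\<^sup>2 = (1 - \<alpha>)\<^sup>2 - 4 * \<alpha>\<close>. It keeps
  \<open>tstar\<close> positive and \<open>tsstar\<close> below
  \<open>1 / (2 * \<gamma>)\<close>.\<close>

lemma S_lt: "S < 1 - \<alpha>"
proof (rule power_less_imp_less_base)
  show "S\<^sup>2 < (1 - \<alpha>)\<^sup>2" unfolding S_sq using \<alpha>_pos by (simp add: power2_eq_square algebra_simps)
qed (use \<alpha>_lt in simp)

lemma tstar_pos: "0 < tstar" unfolding tstar_def
  using S_lt \<alpha>_pos \<gamma>_pos by (intro divide_pos_pos) auto

lemma tstar_le: "tstar \<le> tsstar" unfolding tstar_def tsstar_def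
  using S_nonneg \<gamma>_pos by (intro divide_right_mono) auto

lemma tsstar_lt: "\<gamma> * tsstar < 1 / 2"
  unfolding tsstar_def using S_lt \<gamma>_pos by simp

lemma \<gamma>_r0: "\<gamma> * r0 = 1 - 1 / sqrt 2" using \<gamma>_pos by (simp add: r0_def)

lemma r0_lt: "\<gamma> * r0 < 1" unfolding \<gamma>_r0 by simp

text \<open>Exhibits the gap \<open>r0 - tstar\<close> through two nonnegative quantities, which
  both vanish exactly at the critical \<alpha>.\<close>

lemma tstar_eq: "tstar = r0 - ((3 - 2 * sqrt 2 - \<alpha>) + S) / (4 * \<gamma>)"
proof -
  have "r0 = (4 - 2 * sqrt 2) / (4 * \<gamma>)"
    using \<gamma>_pos by (simp add: r0_def field_simps)
  then show ?thesis by (simp add: tstar_def flip: diff_divide_distrib)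
qed

lemma tstar_le_r0: "tstar \<le> r0"
  unfolding tstar_eq using \<gamma>_pos S_nonneg \<alpha>_le by simp

lemma tstar_lt_r0:
  assumes "\<alpha> < 3 - 2 * sqrt 2" shows "tstar < r0"
proof -
  have "0 < ((3 - 2 * sqrt 2 - \<alpha>) + S) / (4 * \<gamma>)"
    using \<gamma>_pos S_nonneg assms by (intro divide_pos_pos) auto
  then show ?thesis unfolding tstar_eq by simp
qed

lemma \<gamma>_mult_mono: "a \<le> b \<Longrightarrow> \<gamma> * a \<le> \<gamma> * b" and \<gamma>_mult_strict_mono: "a < b \<Longrightarrow> \<gamma> * a < \<gamma> * b"
  using \<gamma>_pos by auto

lemma \<gamma>_tstar_lt: "\<gamma> * tstar < 1"
  using \<gamma>_mult_mono[OF tstar_le_r0] r0_lt by linarith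

text \<open>Multiplication by \<open>1 - \<gamma> * t\<close> leaves the quadratic
  \<open>2 * \<gamma> * t\<^sup>2 - (1 + \<alpha>) * t + \<beta>\<close>, factored by Vieta's
  formulas.\<close>

lemma h_factor: "\<gamma> * t < 1 \<Longrightarrow> h t = 2 * \<gamma> * (tstar - t) * (tsstar - t) / (1 - \<gamma> * t)"
proof -
  assume t: "\<gamma> * t < 1"
  have sum: "tstar + tsstar = (1 + \<alpha>) / (2 * \<gamma>)"
    unfolding tstar_def tsstar_def using \<gamma>_pos by (simp add: field_simps)
  have "tstar * tsstar = ((1 + \<alpha>)\<^sup>2 - S\<^sup>2) / (16 * \<gamma>\<^sup>2)"
    unfolding tstar_def tsstar_def by (simp add: power2_eq_square algebra_simps)
  also have "\<dots> = \<beta> / (2 * \<gamma>)"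
    unfolding S_sq \<alpha>_def using \<gamma>_pos by (simp add: power2_eq_square)
  finally have prod: "tstar * tsstar = \<beta> / (2 * \<gamma>)" .
  have "2 * \<gamma> * (tstar - t) * (tsstar - t)
      = 2 * \<gamma> * (tstar * tsstar) - 2 * \<gamma> * (tstar + tsstar) * t + 2 * \<gamma> * t\<^sup>2"
    by (simp add: algebra_simps power2_eq_square)
  also have "\<dots> = \<beta> - (1 + \<alpha>) * t + 2 * \<gamma> * t\<^sup>2"
    unfolding sum prod using \<gamma>_pos by simp
  also have "\<dots> = h t * (1 - \<gamma> * t)"
    using t by (simp add: majorant_def \<alpha>_def field_simps power2_eq_square)
  finally show ?thesis using t by (simp add: field_simps)
qed

lemma h_tstar: "h tstar = 0" using h_factor[OF \<gamma>_tstar_lt] by simp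

lemma h_pos: "t < tstar \<Longrightarrow> 0 < h t"
proof -
  assume t: "t < tstar"
  then have "\<gamma> * t < 1" using \<gamma>_mult_strict_mono[OF t] \<gamma>_tstar_lt by linarith
  then show "0 < h t" unfolding h_factor[OF \<open>\<gamma> * t < 1\<close>]
    using t tstar_le \<gamma>_pos by (intro divide_pos_pos mult_pos_pos) auto
qed

lemma h_nonneg_imp_le_tstar:
  assumes "0 \<le> h t" and "t < tsstar"
  shows "t \<le> tstar"
proof (rule ccontr)
  assume "\<not> t \<le> tstar"
  have "\<gamma> * t < 1" using \<gamma>_mult_strict_mono[OF assms(2)] tsstar_lt by linarith
  then have "h t < 0" unfolding h_factor[OF \<open>\<gamma> * t < 1\<close>]
    using \<open>\<not> t \<le> tstar\<close> assms(2) \<gamma>_pos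
    by (intro divide_neg_pos mult_neg_pos mult_pos_neg) auto
  then show False using assms(1) by simp
qed

text \<open>
  The last term is the exact remainder, so convexity of the majorant needs no second derivative.
\<close>

lemma h_expansion:
  assumes "\<gamma> * t < 1" and "\<gamma> * s < 1"
  shows "h s = h t + dh t * (s - t) + \<gamma> * (s - t)\<^sup>2 / ((1 - \<gamma> * t)\<^sup>2 * (1 - \<gamma> * s))"
proof -
  define a b where "a = 1 - \<gamma> * s" and "b = 1 - \<gamma> * t"
  have ab: "0 < a" "0 < b" using assms by (auto simp: a_def b_def)
  \<comment> \<open>In the variable \<open>c\<close> the majorant combines only
    \<open>1 / c\<close>, \<open>c\<close> and a constant, so the claim becomes a rational identity
    in \<open>a\<close> and \<open>b\<close>.\<close>
  have h: "h z = \<beta> + (1 / c - 3 + 2 * c) / \<gamma>" if "c = 1 - \<gamma> * z" "0 < c" for z c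
  proof -
    have z: "z = (1 - c) / \<gamma>" using that(1) \<gamma>_pos by (simp add: field_simps)
    show ?thesis
      unfolding majorant_def that(1)[symmetric] unfolding z
      using that(2) \<gamma>_pos by (simp add: field_simps power2_eq_square)
  qed
  have ts: "s - t = (b - a) / \<gamma>"
    using \<gamma>_pos by (simp add: a_def b_def field_simps)
  have "1 / a - 1 / b - (b - a) / b\<^sup>2 = (b - a)\<^sup>2 / (b\<^sup>2 * a)"
    using ab by (simp add: field_simps power2_eq_square)
  then have "(1 / a - 1 / b - (b - a) / b\<^sup>2) / \<gamma> = \<gamma> * (s - t)\<^sup>2 / (b\<^sup>2 * a)"
    unfolding ts using \<gamma>_pos by (simp add: power_divide power2_eq_square)
  moreover have "h s - h t - dh t * (s - t) = (1 / a - 1 / b - (b - a) / b\<^sup>2) / \<gamma>"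
    unfolding h[OF a_def ab(1)] h[OF b_def ab(2)] dmajorant_def b_def[symmetric] ts
    by (simp add: algebra_simps diff_divide_distrib add_divide_distrib)
  ultimately show ?thesis by (simp add: a_def b_def)
qed

lemma h_deriv:
  assumes "\<gamma> * t < 1"
  shows "(h has_real_derivative dh t) (at t)"
proof -
  have c: "1 - \<gamma> * t \<noteq> 0" using assms by simp
  have "((\<lambda>t. \<beta> - t + \<gamma> * t\<^sup>2 / (1 - \<gamma> * t)) has_real_derivative
      (0 - 1 + (\<gamma> * (2 * t) * (1 - \<gamma> * t) - \<gamma> * t\<^sup>2 * (0 - \<gamma>)) / ((1 - \<gamma> * t) * (1 - \<gamma> * t)))) (at t)"
    using c by (auto intro!: derivative_eq_intros)
  moreover have "\<gamma> * (2 * t) * (1 - \<gamma> * t) - \<gamma> * t\<^sup>2 * (0 - \<gamma>) = 1 - (1 - \<gamma> * t) * (1 - \<gamma> * t)"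
    by (simp add: power2_eq_square algebra_simps)
  ultimately show ?thesis
    using c unfolding majorant_def[abs_def] dmajorant_def by (simp add: diff_divide_distrib power2_eq_square)
qed

lemma dh_mono:
  assumes "t \<le> s" and "\<gamma> * s < 1" shows "dh t \<le> dh s"
proof -
  have "\<gamma> * t \<le> \<gamma> * s" by (rule \<gamma>_mult_mono[OF assms(1)])
  then show ?thesis unfolding dmajorant_def
    using assms(2) by (intro diff_right_mono divide_left_mono power_mono) auto
qed

lemma dh_0 [simp]: "dh 0 = -1" and h_0 [simp]: "h 0 = \<beta>"
  by (simp_all add: dmajorant_def majorant_def)

text \<open>\<open>r0\<close> is the zero of \<open>dh\<close>, because
  \<open>1 - \<gamma> * r0 = 1 / sqrt 2\<close>; to its left the denominator in \<open>dh\<close> is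
  larger.\<close>

lemma dh_neg:
  assumes "t < r0" shows "dh t < 0"
proof -
  have "1 / sqrt 2 < 1 - \<gamma> * t"
    using \<gamma>_mult_strict_mono[OF assms] \<gamma>_r0 by linarith
  then have "(1 / sqrt 2)\<^sup>2 < (1 - \<gamma> * t)\<^sup>2"
    by (intro power_strict_mono) auto
  then have "1 / 2 < (1 - \<gamma> * t)\<^sup>2" by (simp add: power_divide)
  then show ?thesis by (simp add: dmajorant_def divide_less_eq)
qed

text \<open>By convexity a tangent taken left of \<open>tstar\<close> meets zero before
  \<open>tstar\<close>. The second half step keeps the slope at \<open>t\<close>, at least as steep
  as the one at \<open>s\<close>, so it is no longer than Newton's step from
  \<open>s\<close>.\<close>

lemma h_step:
  assumes t: "t < tstar"
  defines "s \<equiv> t - h t / dh t"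
  defines "r \<equiv> s - h s / dh t"
  shows "t < s" "s < tstar" "s < r" "r < tstar"
proof -
  have d: "dh t < 0" using dh_neg t tstar_le_r0 by simp
  have lt: "\<gamma> * z < 1" if "z < tstar" for z
    using \<gamma>_mult_strict_mono[OF that] \<gamma>_tstar_lt by linarith
  have below: "h z < - dh z * (tstar - z)" if "z < tstar" for z
  proof -
    have "0 < \<gamma> * (tstar - z)\<^sup>2 / ((1 - \<gamma> * z)\<^sup>2 * (1 - \<gamma> * tstar))"
      using \<gamma>_pos that lt[OF that] \<gamma>_tstar_lt by (intro divide_pos_pos mult_pos_pos) auto
    then show ?thesis
      using h_expansion[OF lt[OF that] \<gamma>_tstar_lt] h_tstar by simp
  qed
  show "t < s" using h_pos[OF t] d by (simp add: s_def divide_pos_neg)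
  show st: "s < tstar"
    using below[OF t] d by (simp add: s_def field_simps)
  show "s < r" using h_pos[OF st] d by (simp add: r_def divide_pos_neg)
  have "dh t \<le> dh s" using \<open>t < s\<close> lt[OF st] by (intro dh_mono) auto
  then have "- dh s * (tstar - s) \<le> - dh t * (tstar - s)"
    using st by (intro mult_right_mono) auto
  then have "h s < - dh t * (tstar - s)" using below[OF st] by linarith
  then show "r < tstar" using d by (simp add: r_def field_simps)
qed

text \<open>The origin of \<open>3 - \<alpha> + S\<close> in the constants \<open>H\<close> and
  \<open>q\<close>: up to the factor 4 it is the base of the denominators in the derivatives of
  \<open>h\<close> at \<open>tstar\<close>.\<close>

lemma quarter_eq: "(3 - \<alpha> + S) / 4 = 1 - \<gamma> * tstar"
  using \<gamma>_pos by (simp add: tstar_def field_simps)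

text \<open>With \<open>u = 1 - \<gamma> * tstar\<close>, the second identity is
  \<open>h tstar = 0\<close> cleared of its denominator, and the first is the same quadratic after
  \<open>S = 4 * u - 3 + \<alpha>\<close>.\<close>

lemma quarter_identity: "S * (1 - \<gamma> * tstar) = 2 * (1 - \<gamma> * tstar)\<^sup>2 - 1"
  and \<alpha>_quarter: "\<alpha> * (1 - \<gamma> * tstar) = 3 * (1 - \<gamma> * tstar) - 1 - 2 * (1 - \<gamma> * tstar)\<^sup>2"
proof -
  have S: "S * S = 1 - 6 * \<alpha> + \<alpha> * \<alpha>"
    using S_sq by (simp add: power2_eq_square algebra_simps)
  show "S * (1 - \<gamma> * tstar) = 2 * (1 - \<gamma> * tstar)\<^sup>2 - 1"
    unfolding quarter_eq[symmetric] using S by (simp add: power2_eq_square field_simps)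
  show "\<alpha> * (1 - \<gamma> * tstar) = 3 * (1 - \<gamma> * tstar) - 1 - 2 * (1 - \<gamma> * tstar)\<^sup>2"
    unfolding quarter_eq[symmetric] using S by (simp add: power2_eq_square field_simps)
qed

text \<open>
  In terms of \<open>u = 1 - \<gamma> * tstar\<close> one has \<open>\<alpha> = 3 - 1 / u - 2 * u\<close> and \<open>S * u = 2 * u\<^sup>2 - 1\<close>, so the claim is
  \<open>2 * u ^ 3 > 1\<close>, and the threshold for \<open>\<alpha>\<close> is the value at \<open>u = 1 / root 3 2\<close>. The inequality is the
  positivity of the denominator of \<open>q\<close>.
\<close>

lemma cubic_threshold:
  assumes "\<alpha> < 3 - root 3 2 - root 3 4"
  shows "\<gamma> * tstar < S * (1 - \<gamma> * tstar)\<^sup>2"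
proof -
  define u where "u = 1 - \<gamma> * tstar"
  define b where "b = root 3 2"
  have u: "0 < u" "u < 1" using \<gamma>_tstar_lt \<gamma>_pos tstar_pos by (auto simp: u_def)
  have b3: "b * b * b = 2"
    using real_root_pow_pos2[of 3 2] by (simp add: b_def power3_eq_cube)
  have b1: "1 < b" by (simp add: b_def)
  have "root 3 4 = root 3 2 * root 3 2" by (simp flip: real_root_mult)
  then have \<alpha>: "\<alpha> < 3 - b - b * b" using assms by (simp add: b_def)
  have "b * b < 2"
  proof (rule ccontr)
    assume "\<not> b * b < 2"
    then have "2 * b \<le> b * b * b" using b1 by (intro mult_right_mono) auto
    then show False using b3 b1 by simp
  qed
  moreover have "1 \<le> 2 * (u * u)"
    using quarter_identity mult_nonneg_nonneg[OF S_nonneg less_imp_le[OF u(1)]]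
    by (simp add: u_def power2_eq_square)
  ultimately have "(b / 2)\<^sup>2 < u\<^sup>2" by (simp add: power2_eq_square)
  then have ub: "b / 2 < u" by (rule power_less_imp_less_base) (use u in simp)
  have "\<alpha> * u < (3 - b - b * b) * u" using \<alpha> u by (intro mult_strict_right_mono)
  \<comment> \<open>The quadratic in \<open>u\<close> has the zeros \<open>b / 2\<close> and
    \<open>1 / b\<close>. As \<open>u\<close> lies to the right of the smaller one, positivity
    pushes it beyond \<open>1 / b\<close>.\<close>
  then have "0 < b * (2 * (u * u) - (b + b * b) * u + 1)"
    using \<alpha>_quarter b1 by (intro mult_pos_pos) (simp_all add: u_def power2_eq_square algebra_simps)
  also have "\<dots> = 2 * b * (u * u) - b * b * u - (b * b * b) * u + b"
    by (simp add: algebra_simps)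
  also have "\<dots> = (b * u - 1) * (2 * u - b)"
    unfolding b3 by (simp add: algebra_simps)
  finally have "1 < b * u"
    using ub by (simp add: zero_less_mult_iff)
  then have "1 < (b * u) ^ 3" by simp
  also have "\<dots> = (b * b * b) * (u * u * u)" by (simp add: power3_eq_cube mult_ac)
  finally have "1 < 2 * (u * u * u)" unfolding b3 .
  moreover have "S * u\<^sup>2 = (2 * u\<^sup>2 - 1) * u"
    using quarter_identity by (simp add: u_def power2_eq_square)
  ultimately have "1 - u < S * u\<^sup>2" by (simp add: power2_eq_square algebra_simps)
  then show ?thesis by (simp add: u_def)
qed

lemma \<alpha>_strict:
  assumes "S \<noteq> 0" shows "\<alpha> < 3 - 2 * sqrt 2"
proof (rule ccontr)
  assume "\<not> \<alpha> < 3 - 2 * sqrt 2"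
  then have "\<alpha> = 3 - 2 * sqrt 2" using \<alpha>_le by simp
  then have "S = 0" unfolding S_def discriminant by simp
  then show False using assms by simp
qed

text \<open>With \<open>u = 1 - \<gamma> * tstar\<close> one has \<open>- dh tstar = S / u\<close>,
  so both sides equal \<open>2 * \<gamma> / (S * u\<^sup>2)\<close>. This is the constant
  \<open>H\<close> up to sign.\<close>

lemma cubic_constant:
  assumes "S \<noteq> 0"
  shows "2 * \<gamma> / (1 - \<gamma> * tstar) ^ 3 / - dh tstar = 32 * \<gamma> / (S * (3 - \<alpha> + S)\<^sup>2)"
proof -
  define u where "u = 1 - \<gamma> * tstar"
  have u: "0 < u" using \<gamma>_tstar_lt by (simp add: u_def)
  have q: "3 - \<alpha> + S = 4 * u" using quarter_eq by (simp add: u_def)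
  have Su: "S * u = 2 * u\<^sup>2 - 1" using quarter_identity by (simp add: u_def)
  have dh: "- dh tstar = S / u"
  proof -
    have "S / u = (S * u) / u\<^sup>2" using u by (simp add: power2_eq_square)
    also have "\<dots> = 2 - 1 / u\<^sup>2" unfolding Su using u by (simp add: diff_divide_distrib)
    finally show ?thesis by (simp add: dmajorant_def u_def)
  qed
  then show ?thesis
    unfolding q u_def[symmetric] dh using u assms by (simp add: field_simps power2_eq_square power3_eq_cube)
qed

text \<open>For \<open>w = S * (1 - \<gamma> * tstar)\<^sup>2\<close> and
  \<open>g = \<gamma> * tstar\<close> the sides are \<open>(w + g) / w\<close> and
  \<open>(w + g) / (w - g)\<close>; the hypothesis keeps the smaller denominator positive.\<close>

lemma cubic_factor_le:
  assumes "\<gamma> * tstar < S * (1 - \<gamma> * tstar)\<^sup>2"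
  shows "1 + (32 * \<gamma> / (S * (3 - \<alpha> + S)\<^sup>2)) / 2 * tstar
    \<le> (S * (3 - \<alpha> + S)\<^sup>2 + 4 * (1 + \<alpha> - S)) / (S * (3 - \<alpha> + S)\<^sup>2 - 4 * (1 + \<alpha> - S))"
proof -
  define w where "w = S * (1 - \<gamma> * tstar)\<^sup>2"
  define g where "g = \<gamma> * tstar"
  have "3 - \<alpha> + S = 4 * (1 - \<gamma> * tstar)" using quarter_eq by simp
  then have w: "S * (3 - \<alpha> + S)\<^sup>2 = 16 * w"
    by (simp only: w_def power_mult_distrib) simp
  have g: "4 * (1 + \<alpha> - S) = 16 * g"
    using \<gamma>_pos by (simp add: g_def tstar_def)
  have gw: "0 < g" "g < w" using assms \<gamma>_pos tstar_pos by (auto simp: g_def w_def)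
  have "(w + g) * (w - g) \<le> (w + g) * w" using gw by (intro mult_left_mono) auto
  then have "1 + g / w \<le> (w + g) / (w - g)"
    using gw by (simp add: field_simps)
  also have "(w + g) / (w - g) = (16 * (w + g)) / (16 * (w - g))" by (rule mult_divide_mult_cancel_left[symmetric]) simp
  also have "\<dots> = (16 * w + 16 * g) / (16 * w - 16 * g)"
    by (simp only: distrib_left right_diff_distrib)
  finally show ?thesis unfolding w g by (simp add: g_def)
qed

end

section \<open>Series for the first and second derivatives of the majorant\<close>

lemma geometric_deriv2_sums:
  fixes y :: real
  assumes "\<bar>y\<bar> < 1"
  shows "(\<lambda>n. (1 + real n) * (2 + real n) * y ^ n) sums (2 / (1 - y) ^ 3)"
proof -
  have "(\<lambda>n. diffs (\<lambda>n. of_nat (Suc n)) n * y ^ n) sums (2 / (1 - y) ^ 3)"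
  proof (rule termdiffs_sums_strong)
    show "(\<lambda>n. of_nat (Suc n) * z ^ n) sums (1 / (1 - z)\<^sup>2)" if "norm z < 1" for z :: real
      by (rule geometric_deriv_sums[OF that])
    have "1 - y \<noteq> 0" using assms by auto
    then have "((\<lambda>z. 1 / (1 - z)\<^sup>2) has_real_derivative
        (0 * (1 - y)\<^sup>2 - 1 * (2 * (1 - y) * (0 - 1))) / ((1 - y)\<^sup>2 * (1 - y)\<^sup>2)) (at y)"
      by (auto intro!: derivative_eq_intros)
    moreover have "(0 * c\<^sup>2 - 1 * (2 * c * (0 - 1))) / (c\<^sup>2 * c\<^sup>2) = 2 / c ^ 3" if "c \<noteq> 0" for c :: real
      using that by (simp add: power2_eq_square power3_eq_cube)
    ultimately show "((\<lambda>z. 1 / (1 - z)\<^sup>2) has_real_derivative 2 / (1 - y) ^ 3) (at y)"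
      using \<open>1 - y \<noteq> 0\<close> by metis
  qed (use assms in simp)
  then show ?thesis by (simp add: diffs_def algebra_simps)
qed

lemma dmajorant_diff_sums:
  assumes "\<bar>\<gamma> * a\<bar> < 1" and "\<bar>\<gamma> * b\<bar> < 1"
  shows "(\<lambda>n. (1 + real n) * (\<gamma> ^ n * (b ^ n - a ^ n))) sums (dmajorant \<gamma> b - dmajorant \<gamma> a)"
  using sums_diff[OF geometric_deriv_sums[of "\<gamma> * b"] geometric_deriv_sums[of "\<gamma> * a"]] assms
  by (simp add: dmajorant_def power_mult_distrib algebra_simps)

lemma ddmajorant_sums:
  assumes "\<bar>\<gamma> * \<rho>\<bar> < 1"
  shows "(\<lambda>n. (1 + real n) * (\<gamma> ^ n * d * (real n * \<rho> ^ (n - 1)))) sums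
    (2 * \<gamma> / (1 - \<gamma> * \<rho>) ^ 3 * d)"
proof -
  let ?f = "\<lambda>n. (1 + real n) * (\<gamma> ^ n * d * (real n * \<rho> ^ (n - 1)))"
  have "(\<lambda>n. (\<gamma> * d) * ((1 + real n) * (2 + real n) * (\<gamma> * \<rho>) ^ n)) sums
    ((\<gamma> * d) * (2 / (1 - \<gamma> * \<rho>) ^ 3))"
    by (intro sums_mult geometric_deriv2_sums assms)
  then have "(\<lambda>n. ?f (Suc n)) sums (2 * \<gamma> / (1 - \<gamma> * \<rho>) ^ 3 * d)"
    by (simp add: power_mult_distrib mult_ac)
  then show ?thesis by (subst (asm) sums_Suc_iff) simp
qed

section \<open>Majorized two-step Newton iteration\<close>

text \<open>The operator is now seen only through two estimates of its derivative, one matched to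
  \<open>dh\<close> and one Lipschitz. \<open>U\<close> may exceed \<open>ball x0 r0\<close>, since
  uniqueness concerns zeros up to distance \<open>tsstar\<close>, which can be larger than
  \<open>r0\<close>.\<close>

locale two_step_newton_majorized = smale_majorant \<beta> \<gamma> \<alpha> S tstar tsstar r0
  for \<beta> \<gamma> \<alpha> S tstar tsstar r0 :: real +
  fixes G :: "'a::banach \<Rightarrow> 'a" and G' :: "'a \<Rightarrow> 'a \<Rightarrow> 'a" and U :: "'a set" and x0 :: 'a
  assumes U: "convex U" "ball x0 r0 \<subseteq> U" "U \<subseteq> ball x0 (1 / \<gamma>)"
    and deriv: "x \<in> U \<Longrightarrow> (G has_derivative G' x) (at x)"
    and deriv_x0: "G' x0 u = u"
    and norm_G_x0: "norm (G x0) = \<beta>"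
    and deriv_diff: "x \<in> U \<Longrightarrow> w \<in> U \<Longrightarrow> norm (x - x0) \<le> a \<Longrightarrow> norm (w - x) \<le> d \<Longrightarrow> \<gamma> * (a + d) < 1
      \<Longrightarrow> norm (G' w u - G' x u) \<le> (dmajorant \<gamma> (a + d) - dmajorant \<gamma> a) * norm u"
    and deriv_Lipschitz: "x \<in> U \<Longrightarrow> w \<in> U \<Longrightarrow> norm (x - x0) \<le> \<rho> \<Longrightarrow> norm (w - x0) \<le> \<rho> \<Longrightarrow> \<gamma> * \<rho> < 1
      \<Longrightarrow> norm (G' w u - G' x u) \<le> 2 * \<gamma> / (1 - \<gamma> * \<rho>) ^ 3 * norm (w - x) * norm u"
begin

lemma \<gamma>_lt: "t \<le> r0 \<Longrightarrow> \<gamma> * t < 1"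
  using \<gamma>_mult_mono[of t r0] r0_lt by linarith

lemma r0_pos: "0 < r0" using tstar_pos tstar_le_r0 by linarith

lemma x0_in_U: "x0 \<in> U" using U(2) r0_pos by auto

lemma in_U: "norm (x - x0) < r0 \<Longrightarrow> x \<in> U"
  using U(2) by (auto simp: dist_norm norm_minus_commute)

lemma bounded_linear_deriv: "x \<in> U \<Longrightarrow> bounded_linear (G' x)"
  using deriv has_derivative_bounded_linear by blast

lemma deriv_near_id:
  assumes "x \<in> U" and "norm (x - x0) \<le> t" and "\<gamma> * t < 1"
  shows "norm (G' x u - u) \<le> (dh t + 1) * norm u"
  using deriv_diff[OF x0_in_U assms(1), of 0 t u] assms(2,3) by (simp add: deriv_x0)

text \<open>The distance from the identity is at most \<open>dh t + 1\<close>, which is below 1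
  because \<open>t < r0\<close>; the remaining gap \<open>- dh t\<close> bounds the inverse.\<close>

lemma
  assumes x: "norm (x - x0) \<le> t" "t < r0"
  shows nonsingular_deriv: "nonsingular (G' x)"
    and norm_inv_deriv: "norm (inv (G' x) v) \<le> norm v / - dh t"
proof -
  have t: "0 \<le> t" using x norm_ge_zero order_trans by blast
  have xU: "x \<in> U" using x by (intro in_U) simp
  have q: "0 \<le> dh t + 1" "dh t + 1 < 1"
    using dh_mono[OF t \<gamma>_lt] dh_neg[OF x(2)] x(2) by auto
  note near = deriv_near_id[OF xU x(1) \<gamma>_lt]
  show "nonsingular (G' x)"
    by (rule nonsingular_near_id(1)[OF bounded_linear_deriv[OF xU] q near]) (use x in simp)
  show "norm (inv (G' x) v) \<le> norm v / - dh t"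
    using nonsingular_near_id(2)[OF bounded_linear_deriv[OF xU] q near, of v] x(2) by simp
qed

text \<open>Along the segment the derivative differs from \<open>G' x\<close> by at most
  \<open>dh (\<sigma> \<tau>) - dh t\<close>, with \<sigma> moving from \<open>s\<close> to
  \<open>r\<close>. The base \<open>x\<close> is separate from \<open>p\<close> because the second
  half step reuses the derivative at \<open>x\<close>.\<close>

lemma majorized_linearization:
  assumes "x \<in> U" "p \<in> U" "q \<in> U" and x: "norm (x - x0) \<le> t" and p: "norm (p - x) \<le> s - t"
    and q: "norm (q - p) \<le> r - s" and r: "\<gamma> * r < 1"
  shows "norm (G q - G p - G' x (q - p)) \<le> h r - h s - dh t * (r - s)"
proof -
  have ts: "t \<le> s" using p norm_ge_zero[of "p - x"] by linarith
  have sr: "s \<le> r" using q norm_ge_zero[of "q - p"] by linarith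
  define \<sigma> where "\<sigma> \<tau> = s + \<tau> * (r - s)" for \<tau>
  have \<sigma>: "t \<le> \<sigma> \<tau>" "\<gamma> * \<sigma> \<tau> < 1" if "0 \<le> \<tau>" "\<tau> \<le> 1" for \<tau>
  proof -
    have "0 \<le> \<tau> * (r - s)" using that sr by simp
    then show "t \<le> \<sigma> \<tau>" using ts by (simp add: \<sigma>_def)
    have "\<tau> * (r - s) \<le> 1 * (r - s)" using that sr by (intro mult_right_mono) auto
    then have "\<sigma> \<tau> \<le> r" by (simp add: \<sigma>_def)
    then show "\<gamma> * \<sigma> \<tau> < 1" using \<gamma>_mult_mono r by fastforce
  qed
  have "norm (G q - G p - G' x (q - p))
      \<le> (h (\<sigma> 1) - 1 * (dh t * (r - s))) - (h (\<sigma> 0) - 0 * (dh t * (r - s)))"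
  proof (rule has_derivative_segment_bound[OF U(1) assms(2,3) deriv])
    fix \<tau> :: real assume \<tau>: "0 \<le> \<tau>" "\<tau> \<le> 1"
    have "(\<sigma> has_real_derivative (r - s)) (at \<tau>)"
      unfolding \<sigma>_def by (auto intro!: derivative_eq_intros)
    from DERIV_chain2[OF h_deriv[OF \<sigma>(2)[OF \<tau>]] this]
    show "((\<lambda>\<tau>. h (\<sigma> \<tau>) - \<tau> * (dh t * (r - s))) has_real_derivative
        (dh (\<sigma> \<tau>) - dh t) * (r - s)) (at \<tau>)"
      by (auto intro!: derivative_eq_intros simp: algebra_simps)
    let ?w = "p + \<tau> *\<^sub>R (q - p)"
    assume w: "?w \<in> U"
    have "?w - x = (p - x) + \<tau> *\<^sub>R (q - p)" by simp
    then have "norm (?w - x) \<le> norm (p - x) + \<tau> * norm (q - p)"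
      using norm_triangle_ineq[of "p - x" "\<tau> *\<^sub>R (q - p)"] \<tau>(1) by (simp only: norm_scaleR abs_of_nonneg)
    also have "\<dots> \<le> \<sigma> \<tau> - t"
      using p mult_left_mono[OF q \<tau>(1)] by (simp add: \<sigma>_def)
    finally have "norm (G' ?w (q - p) - G' x (q - p)) \<le> (dh (\<sigma> \<tau>) - dh t) * norm (q - p)"
      using deriv_diff[OF assms(1) w x, of "\<sigma> \<tau> - t"] \<sigma>(2)[OF \<tau>] by simp
    also have "\<dots> \<le> (dh (\<sigma> \<tau>) - dh t) * (r - s)"
      using q dh_mono[OF \<sigma>[OF \<tau>]] by (intro mult_left_mono) auto
    finally show "norm (G' ?w (q - p) - G' x (q - p)) \<le> (dh (\<sigma> \<tau>) - dh t) * (r - s)" .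
  qed
  then show ?thesis by (simp add: \<sigma>_def)
qed

text \<open>
  The invariant of the iteration: it passes from \<open>(t, x)\<close> to the result of one two-step Newton
  iteration for the majorant at \<open>t\<close> and for \<open>G\<close> at \<open>x\<close>.
\<close>

definition majorized :: "real \<Rightarrow> 'a \<Rightarrow> bool" where
  "majorized t x \<longleftrightarrow> t < tstar \<and> norm (x - x0) \<le> t \<and> norm (G x) \<le> h t"

definition half_step :: "'a \<Rightarrow> 'a" where "half_step x = x - inv (G' x) (G x)"

definition full_step :: "'a \<Rightarrow> 'a" where
  "full_step x = half_step x - inv (G' x) (G (half_step x))"

definition scalar_half_step :: "real \<Rightarrow> real" where "scalar_half_step t = t - h t / dh t"

definition scalar_step :: "real \<Rightarrow> real" where
  "scalar_step t = scalar_half_step t - h (scalar_half_step t) / dh t"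

text \<open>Each half step cancels the linearization, for \<open>G\<close> at \<open>x\<close> as
  for \<open>h\<close> at \<open>t\<close>. What remains is the new residual, bounded by the new
  value of \<open>h\<close>, and the bound on the inverse keeps the next correction within its
  scalar counterpart.\<close>

lemma
  assumes "majorized t x"
  shows norm_half_step: "norm (half_step x - x0) < tstar"
    and majorized_full_step: "majorized (scalar_step t) (full_step x)"
    and norm_full_step_diff: "norm (full_step x - x) \<le> scalar_step t - t"
    and half_step_lt: "scalar_half_step t \<le> scalar_step t"
proof -
  have t: "t < tstar" and x: "norm (x - x0) \<le> t" and Gx: "norm (G x) \<le> h t"
    using assms by (auto simp: majorized_def)
  let ?s = "scalar_half_step t" and ?r = "scalar_step t"
  let ?y = "half_step x" and ?z = "full_step x"
  have tr0: "t < r0" using t tstar_le_r0 by simp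
  have steps: "t < ?s" "?s < tstar" "?s < ?r" "?r < tstar"
    using h_step[OF t] by (simp_all add: scalar_half_step_def scalar_step_def)
  show "?s \<le> ?r" using steps by simp
  note lt = \<gamma>_lt[OF order_trans[OF less_imp_le tstar_le_r0]]
  have d: "0 < - dh t" using dh_neg[OF tr0] by simp
  have inv: "G' x (inv (G' x) v) = v" for v
    using nonsingular_deriv[OF x tr0] by (simp add: nonsingular_def bij_is_surj surj_f_inv_f)
  have xU: "x \<in> U" using x tr0 by (intro in_U) simp
  interpret G': bounded_linear "G' x" by (rule bounded_linear_deriv[OF xU])
  have "norm (?y - x) = norm (inv (G' x) (G x))" by (simp add: half_step_def)
  also have "\<dots> \<le> h t / - dh t"
    using norm_inv_deriv[OF x tr0, of "G x"] divide_right_mono[OF Gx, of "- dh t"] d by linarith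
  finally have y: "norm (?y - x) \<le> ?s - t" by (simp add: scalar_half_step_def)
  have "norm (?y - x0) \<le> ?s"
    using norm_triangle_ineq[of "?y - x" "x - x0"] x y by simp
  then show y0: "norm (?y - x0) < tstar" using steps by simp
  have yU: "?y \<in> U" using y0 tstar_le_r0 by (intro in_U) simp
  have ds: "dh t * (?s - t) = - h t"
    using d by (simp add: scalar_half_step_def)
  have dr: "dh t * (?r - ?s) = - h ?s"
    using d by (simp add: scalar_step_def)
  have "norm (G ?y - G x - G' x (?y - x)) \<le> h ?s - h t - dh t * (?s - t)"
    by (rule majorized_linearization) (use xU yU x y lt[OF steps(2)] in auto)
  moreover have "G' x (?y - x) = - G x"
    by (simp add: half_step_def G'.neg inv)
  ultimately have Gy: "norm (G ?y) \<le> h ?s" using ds by simp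
  have "norm (?z - ?y) = norm (inv (G' x) (G ?y))" by (simp add: full_step_def)
  also have "\<dots> \<le> h ?s / - dh t"
    using norm_inv_deriv[OF x tr0, of "G ?y"] divide_right_mono[OF Gy, of "- dh t"] d by linarith
  finally have z: "norm (?z - ?y) \<le> ?r - ?s" by (simp add: scalar_step_def)
  show zx: "norm (?z - x) \<le> ?r - t"
    using norm_triangle_ineq[of "?z - ?y" "?y - x"] y z by simp
  have z0: "norm (?z - x0) \<le> ?r"
    using norm_triangle_ineq[of "?z - x" "x - x0"] x zx by simp
  have zU: "?z \<in> U" using z0 steps tstar_le_r0 by (intro in_U) simp
  have "norm (G ?z - G ?y - G' x (?z - ?y)) \<le> h ?r - h ?s - dh t * (?r - ?s)"
    by (rule majorized_linearization) (use xU yU zU x y z lt[OF steps(4)] in auto)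
  moreover have "G' x (?z - ?y) = - G ?y"
    by (simp add: full_step_def G'.neg inv)
  ultimately have "norm (G ?z) \<le> h ?r" using dr by simp
  then show "majorized ?r ?z" using steps z0 by (simp add: majorized_def)
qed

section \<open>Convergence of the iterates\<close>

definition iter :: "nat \<Rightarrow> 'a" where "iter k = (full_step ^^ k) x0"

definition scalar_iter :: "nat \<Rightarrow> real" where "scalar_iter k = (scalar_step ^^ k) 0"

lemma iter_0 [simp]: "iter 0 = x0" and iter_Suc: "iter (Suc k) = full_step (iter k)"
  by (simp_all add: iter_def)

lemma majorized_iter: "majorized (scalar_iter k) (iter k)"
proof (induction k)
  case 0
  then show ?case using tstar_pos norm_G_x0 by (simp add: majorized_def scalar_iter_def)
next
  case (Suc k)
  then show ?case using majorized_full_step by (simp add: iter_Suc scalar_iter_def)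
qed

lemma scalar_iter_bounds: "0 \<le> scalar_iter k" "scalar_iter k < tstar"
  using majorized_iter[of k] norm_ge_zero[of "iter k - x0"] unfolding majorized_def by linarith+

lemma norm_iter_step: "norm (iter (Suc k) - iter k) \<le> scalar_iter (Suc k) - scalar_iter k"
  using norm_full_step_diff[OF majorized_iter] by (simp add: iter_Suc scalar_iter_def)

lemma norm_iter_diff: "k \<le> m \<Longrightarrow> norm (iter m - iter k) \<le> scalar_iter m - scalar_iter k"
proof (induction m rule: dec_induct)
  case (step m)
  then show ?case
    using norm_triangle_ineq[of "iter (Suc m) - iter m" "iter m - iter k"] norm_iter_step[of m] by simp
qed simp

lemma convergent_scalar_iter: "convergent scalar_iter"
proof (rule Bseq_mono_convergent)
  show "Bseq scalar_iter"
    by (rule BseqI'[of _ tstar]) (use scalar_iter_bounds in \<open>auto intro: less_imp_le\<close>)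
  show "\<forall>m n. m \<le> n \<longrightarrow> scalar_iter m \<le> scalar_iter n"
    using norm_iter_diff norm_ge_zero by (metis diff_ge_0_iff_ge order_trans)
qed

lemma convergent_iter: "convergent iter"
proof -
  have "Cauchy iter"
    unfolding Cauchy_altdef2
  proof (intro allI impI)
    fix e :: real assume "0 < e"
    then obtain N where N: "\<And>n. N \<le> n \<Longrightarrow> dist (scalar_iter n) (scalar_iter N) < e"
      using convergent_Cauchy[OF convergent_scalar_iter] unfolding Cauchy_altdef2 by blast
    have "dist (iter n) (iter N) < e" if "N \<le> n" for n
      using N[OF that] norm_iter_diff[OF that] by (simp add: dist_norm)
    then show "\<exists>N. \<forall>n\<ge>N. dist (iter n) (iter N) < e" by blast
  qed
  then show ?thesis by (simp add: Cauchy_convergent_iff)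
qed

definition limit_point :: 'a where "limit_point = lim iter"

lemma iter_tendsto: "iter \<longlonglongrightarrow> limit_point"
  using convergent_iter by (simp add: limit_point_def convergent_LIMSEQ_iff)

text \<open>At \<open>k = 0\<close> this places the limit in the closed ball; for general
  \<open>k\<close> it supplies the uniform error bound behind \<open>q\<close>.\<close>

lemma norm_limit_diff: "norm (limit_point - iter k) \<le> tstar"
proof (rule Lim_norm_ubound)
  show "(\<lambda>m. iter m - iter k) \<longlonglongrightarrow> limit_point - iter k"
    by (intro tendsto_intros iter_tendsto)
  have "norm (iter m - iter k) \<le> tstar" if "k \<le> m" for m
    using norm_iter_diff[OF that] scalar_iter_bounds[of m] scalar_iter_bounds[of k] by linarith
  then show "\<forall>\<^sub>F m in sequentially. norm (iter m - iter k) \<le> tstar"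
    using eventually_sequentially by blast
qed simp

text \<open>As \<open>- dh \<le> 1\<close> on the scalar iterates, the residual is at most a scalar
  half step, hence at most a scalar increment. Continuity at the limit is avoided because the limit
  may lie outside \<open>U\<close>.\<close>

lemma G_iter_tendsto: "(\<lambda>k. G (iter k)) \<longlonglongrightarrow> 0"
proof (rule Lim_null_comparison)
  have "norm (G (iter k)) \<le> scalar_iter (Suc k) - scalar_iter k" for k
  proof -
    note m = majorized_iter[of k]
    let ?t = "scalar_iter k"
    have d: "dh ?t < 0" "-1 \<le> dh ?t"
      using dh_neg[of ?t] dh_mono[of 0 ?t] scalar_iter_bounds[of k] tstar_le_r0 \<gamma>_lt[of ?t] by auto
    have "norm (G (iter k)) \<le> h ?t" using m by (simp add: majorized_def)
    also have "\<dots> \<le> h ?t / - dh ?t"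
    proof -
      have "h ?t * - dh ?t \<le> h ?t * 1"
        using d h_pos[OF scalar_iter_bounds(2)[of k]] by (intro mult_left_mono) auto
      then show ?thesis using d by (subst pos_le_divide_eq) auto
    qed
    also have "\<dots> \<le> scalar_iter (Suc k) - ?t"
      using half_step_lt[OF m] by (simp add: scalar_iter_def scalar_half_step_def)
    finally show ?thesis .
  qed
  then show "\<forall>\<^sub>F k in sequentially. norm (G (iter k)) \<le> scalar_iter (Suc k) - scalar_iter k"
    by simp
  obtain l where l: "scalar_iter \<longlonglongrightarrow> l" using convergent_scalar_iter convergent_def by blast
  show "(\<lambda>k. scalar_iter (Suc k) - scalar_iter k) \<longlonglongrightarrow> 0"
    using tendsto_diff[OF LIMSEQ_Suc[OF l] l] by simp
qed

lemma G_limit_point: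
  assumes "limit_point \<in> U"
  shows "G limit_point = 0"
proof -
  have "isCont G limit_point"
    using deriv[OF assms] has_derivative_continuous by blast
  then have "(\<lambda>k. G (iter k)) \<longlonglongrightarrow> G limit_point"
    using iter_tendsto by (rule isCont_tendsto_compose)
  then show ?thesis using G_iter_tendsto LIMSEQ_unique by blast
qed

section \<open>Uniqueness and order of convergence\<close>

lemma limit_point_unique:
  assumes z: "z \<in> U" "G z = 0" "norm (z - x0) < tsstar" and "tstar < r0"
  shows "z = limit_point"
proof -
  have zero_in: "norm (z - x0) \<le> tstar" if z: "z \<in> U" "G z = 0" "norm (z - x0) < tsstar" for z
  proof (rule h_nonneg_imp_le_tstar[OF _ z(3)])
    let ?s = "norm (z - x0)"
    have "\<gamma> * ?s < 1" using \<gamma>_mult_strict_mono[OF z(3)] tsstar_lt by linarith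
    then have "norm (G z - G x0 - G' x0 (z - x0)) \<le> h ?s - h 0 - dh 0 * (?s - 0)"
      by (intro majorized_linearization) (use z x0_in_U in auto)
    moreover have "G z - G x0 - G' x0 (z - x0) = - ((z - x0) + G x0)"
      by (simp add: z deriv_x0)
    ultimately have "norm ((z - x0) + G x0) \<le> h ?s - \<beta> + ?s"
      by (simp only: norm_minus_cancel) simp
    \<comment> \<open>The reverse triangle inequality bounds the left side below by
      \<open>?s - \<beta>\<close>, which cancels against \<open>- \<beta> + ?s\<close>.\<close>
    then show "0 \<le> h ?s"
      using norm_triangle_ineq2[of "z - x0" "- G x0"] norm_G_x0 by simp
  qed
  have z_in: "norm (z - x0) \<le> tstar" by (rule zero_in) fact+
  have l_in: "norm (limit_point - x0) \<le> tstar" using norm_limit_diff[of 0] by simp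
  let ?l = limit_point
  have lU: "?l \<in> U" using l_in \<open>tstar < r0\<close> by (intro in_U) simp
  have "norm (G z - G ?l - (z - ?l)) \<le> 1 * ((dh tstar + 1) * norm (z - ?l)) - 0 * ((dh tstar + 1) * norm (z - ?l))"
  proof (rule has_derivative_segment_bound[of "cball x0 tstar" ?l z G G'])
    show "?l \<in> cball x0 tstar" "z \<in> cball x0 tstar"
      using z_in l_in by (auto simp: dist_norm norm_minus_commute)
    show "(G has_derivative G' x) (at x)" if "x \<in> cball x0 tstar" for x
      using that \<open>tstar < r0\<close> by (intro deriv in_U) (auto simp: dist_norm norm_minus_commute)
    show "((\<lambda>\<tau>. \<tau> * ((dh tstar + 1) * norm (z - ?l))) has_real_derivative (dh tstar + 1) * norm (z - ?l)) (at \<tau>)" for \<tau>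
      by (auto intro!: derivative_eq_intros)
    show "norm (G' (?l + \<tau> *\<^sub>R (z - ?l)) (z - ?l) - (z - ?l)) \<le> (dh tstar + 1) * norm (z - ?l)"
      if "?l + \<tau> *\<^sub>R (z - ?l) \<in> cball x0 tstar" for \<tau>
      using that \<open>tstar < r0\<close>
      by (intro deriv_near_id in_U \<gamma>_tstar_lt) (auto simp: dist_norm norm_minus_commute)
  qed (rule convex_cball)
  then have "norm (z - ?l) \<le> (dh tstar + 1) * norm (z - ?l)"
    using z(2) G_limit_point[OF lU] by (simp add: norm_minus_commute)
  then have "0 \<le> dh tstar * norm (z - ?l)" by (simp add: algebra_simps)
  then have "norm (z - ?l) = 0"
    using dh_neg[OF \<open>tstar < r0\<close>] by (simp add: zero_le_mult_iff)
  then show ?thesis by simp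
qed

text \<open>
  Here \<open>K = - h'' tstar / h' tstar\<close> with \<open>h\<close> the majorant. The half step gives
  \<open>norm (limit_point - half_step x) \<le> K / 2 * e\<^sup>2\<close>, and the error of the full step is at most
  \<open>K * (e + K / 2 * e\<^sup>2) * (K / 2 * e\<^sup>2)\<close>.
\<close>

lemma cubic_error:
  fixes k :: nat
  assumes "tstar < r0"
  defines "K \<equiv> 2 * \<gamma> / (1 - \<gamma> * tstar) ^ 3 / - dh tstar"
  defines "e \<equiv> norm (limit_point - iter k)"
  shows "norm (limit_point - iter (Suc k)) \<le> K\<^sup>2 / 2 * (1 + K / 2 * e) * e ^ 3"
proof -
  let ?l = limit_point and ?x = "iter k"
  let ?y = "half_step ?x"
  define M where "M = 2 * \<gamma> / (1 - \<gamma> * tstar) ^ 3"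
  have d: "0 < - dh tstar" using dh_neg[OF assms(1)] by simp
  have M: "0 \<le> M" using \<gamma>_pos \<gamma>_tstar_lt by (simp add: M_def)
  have K: "K = M / - dh tstar" by (simp add: K_def M_def)
  have K0: "0 \<le> K" unfolding K using M d by (intro divide_nonneg_pos)
  have x: "norm (?x - x0) \<le> tstar"
    using majorized_iter[of k] by (simp add: majorized_def)
  have y: "norm (?y - x0) \<le> tstar"
    using norm_half_step[OF majorized_iter, of k] by simp
  have l: "norm (?l - x0) \<le> tstar" using norm_limit_diff[of 0] by simp
  have inU: "w \<in> U" if "norm (w - x0) \<le> tstar" for w
    using that assms(1) by (intro in_U) simp
  have cball: "w \<in> cball x0 tstar \<longleftrightarrow> norm (w - x0) \<le> tstar" for w
    by (metis dist_commute dist_norm mem_cball)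
  have Gl: "G ?l = 0" by (rule G_limit_point[OF inU[OF l]])
  have deriv': "(G has_derivative G' w) (at w)" if "w \<in> cball x0 tstar" for w
    using that by (intro deriv inU) (simp only: cball)
  note Lip = deriv_Lipschitz[OF inU inU _ _ \<gamma>_tstar_lt, folded M_def]
  interpret G': bounded_linear "G' ?x" by (rule bounded_linear_deriv[OF inU[OF x]])
  have inv: "inv (G' ?x) (G' ?x v) = v" "G' ?x (inv (G' ?x) v) = v" for v
    using nonsingular_deriv[OF x assms(1)]
    by (simp_all add: nonsingular_def bij_is_inj bij_is_surj surj_f_inv_f)
  have le_inv: "norm v \<le> norm (G' ?x v) / - dh tstar" for v
    using norm_inv_deriv[OF x assms(1), of "G' ?x v"] inv(1)[of v] by simp
  have "norm (G ?l - G ?x - G' ?x (?l - ?x)) \<le> 1\<^sup>2 * (M / 2 * e\<^sup>2) - 0\<^sup>2 * (M / 2 * e\<^sup>2)"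
  proof (rule has_derivative_segment_bound[of "cball x0 tstar" ?x ?l G G'])
    show "((\<lambda>\<tau>. \<tau>\<^sup>2 * (M / 2 * e\<^sup>2)) has_real_derivative 2 * \<tau> * (M / 2 * e\<^sup>2)) (at \<tau>)" for \<tau>
      by (auto intro!: derivative_eq_intros)
    fix \<tau> :: real assume \<tau>: "0 \<le> \<tau>" and w: "?x + \<tau> *\<^sub>R (?l - ?x) \<in> cball x0 tstar"
    have "norm (?x + \<tau> *\<^sub>R (?l - ?x) - ?x) = \<tau> * e" using \<tau> by (simp add: e_def)
    then show "norm (G' (?x + \<tau> *\<^sub>R (?l - ?x)) (?l - ?x) - G' ?x (?l - ?x)) \<le> 2 * \<tau> * (M / 2 * e\<^sup>2)"
      using Lip[of ?x "?x + \<tau> *\<^sub>R (?l - ?x)" "?l - ?x"] x w[unfolded cball] \<tau>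
      by (simp add: e_def power2_eq_square mult_ac)
  qed (use x l deriv' in \<open>auto simp: cball simp del: mem_cball\<close>)
  moreover have "G' ?x (?l - ?y) = - (G ?l - G ?x - G' ?x (?l - ?x))"
    by (simp add: half_step_def Gl G'.diff inv)
  ultimately have "norm (G' ?x (?l - ?y)) \<le> M / 2 * e\<^sup>2"
    by (simp only: norm_minus_cancel) simp
  then have "norm (G' ?x (?l - ?y)) / - dh tstar \<le> M / 2 * e\<^sup>2 / - dh tstar"
    using d by (intro divide_right_mono) auto
  also have "\<dots> = K / 2 * e\<^sup>2" by (simp add: K)
  finally have ly: "norm (?l - ?y) \<le> K / 2 * e\<^sup>2" using le_inv[of "?l - ?y"] by linarith
  define f where "f = norm (?l - ?y)"
  have "norm (G ?l - G ?y - G' ?x (?l - ?y)) \<le> 1 * (M * (e + f) * f) - 0 * (M * (e + f) * f)"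
  proof (rule has_derivative_segment_bound[of "cball x0 tstar" ?y ?l G G'])
    show "((\<lambda>\<tau>. \<tau> * (M * (e + f) * f)) has_real_derivative M * (e + f) * f) (at \<tau>)" for \<tau>
      by (auto intro!: derivative_eq_intros)
    fix \<tau> :: real assume \<tau>: "0 \<le> \<tau>" "\<tau> \<le> 1" and w: "?y + \<tau> *\<^sub>R (?l - ?y) \<in> cball x0 tstar"
    \<comment> \<open>Measured back from the limit, the distance to \<open>?x\<close> involves only
      the errors \<open>e\<close> and \<open>f\<close> of the iterate and its half step.\<close>
    have w_eq: "?y + \<tau> *\<^sub>R (?l - ?y) - ?x = (?l - ?x) - (1 - \<tau>) *\<^sub>R (?l - ?y)"
      by (simp add: algebra_simps)
    have "norm (?y + \<tau> *\<^sub>R (?l - ?y) - ?x) \<le> e + (1 - \<tau>) * f"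
      unfolding w_eq using norm_triangle_ineq4[of "?l - ?x" "(1 - \<tau>) *\<^sub>R (?l - ?y)"] \<tau>
      by (simp add: e_def f_def)
    also have "\<dots> \<le> e + 1 * f"
      using \<tau> by (intro add_left_mono mult_right_mono) (auto simp: f_def)
    finally have "M * norm (?y + \<tau> *\<^sub>R (?l - ?y) - ?x) * f \<le> M * (e + f) * f"
      using M by (intro mult_right_mono mult_left_mono) (auto simp: f_def)
    then show "norm (G' (?y + \<tau> *\<^sub>R (?l - ?y)) (?l - ?y) - G' ?x (?l - ?y)) \<le> M * (e + f) * f"
      using Lip[of ?x "?y + \<tau> *\<^sub>R (?l - ?y)" "?l - ?y"] x w[unfolded cball]
      by (simp add: f_def)
  qed (use y l deriv' in \<open>auto simp: cball simp del: mem_cball\<close>)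
  moreover have "G' ?x (?l - iter (Suc k)) = - (G ?l - G ?y - G' ?x (?l - ?y))"
    by (simp add: iter_Suc full_step_def Gl G'.diff inv)
  ultimately have "norm (G' ?x (?l - iter (Suc k))) \<le> M * (e + f) * f"
    by (simp only: norm_minus_cancel mult_1 mult_zero_left diff_0_right)
  then have "norm (G' ?x (?l - iter (Suc k))) / - dh tstar \<le> M * (e + f) * f / - dh tstar"
    using d by (intro divide_right_mono) auto
  then have "norm (?l - iter (Suc k)) \<le> K * ((e + f) * f)"
    using le_inv[of "?l - iter (Suc k)"] by (simp add: K mult_ac)
  also have "\<dots> \<le> K * ((e + K / 2 * e\<^sup>2) * (K / 2 * e\<^sup>2))"
    using K0 ly by (intro mult_left_mono mult_mono add_left_mono) (auto simp: f_def e_def)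
  also have "\<dots> = K\<^sup>2 / 2 * (1 + K / 2 * e) * e ^ 3"
    by (simp add: power2_eq_square power3_eq_cube algebra_simps)
  finally show ?thesis .
qed

lemma cubic_error_tstar:
  assumes "tstar < r0"
  defines "K \<equiv> 2 * \<gamma> / (1 - \<gamma> * tstar) ^ 3 / - dh tstar"
  shows "norm (limit_point - iter (Suc k))
    \<le> K\<^sup>2 / 2 * (1 + K / 2 * tstar) * norm (limit_point - iter k) ^ 3"
proof -
  have "0 \<le> K"
    using \<gamma>_pos \<gamma>_tstar_lt dh_neg[OF assms(1)] unfolding K_def by (intro divide_nonneg_pos) auto
  then have "K\<^sup>2 / 2 * (1 + K / 2 * norm (limit_point - iter k)) * norm (limit_point - iter k) ^ 3
      \<le> K\<^sup>2 / 2 * (1 + K / 2 * tstar) * norm (limit_point - iter k) ^ 3"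
    by (intro mult_right_mono mult_left_mono add_left_mono norm_limit_diff) auto
  then show ?thesis using cubic_error[OF assms(1), of k] unfolding K_def by linarith
qed

text \<open>One factor of the cubic bound is spent: \<open>C * norm (iter k - limit_point)\<close>
  tends to 0 and drops below any \<open>c\<close>.\<close>

lemma Q_superquadratic:
  assumes "tstar < r0"
  shows "converges_Q_superquadratically iter limit_point"
  unfolding converges_Q_superquadratically_def
proof (intro conjI allI impI iter_tendsto)
  fix c :: real assume "0 < c"
  obtain C where C: "\<And>k. norm (limit_point - iter (Suc k)) \<le> C * norm (limit_point - iter k) ^ 3"
    using cubic_error_tstar[OF assms] by blast
  have "(\<lambda>k. C * norm (iter k - limit_point)) \<longlonglongrightarrow> C * norm (limit_point - limit_point)"
    by (intro tendsto_intros iter_tendsto)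
  then have "\<forall>\<^sub>F k in sequentially. C * norm (iter k - limit_point) < c"
    by (rule order_tendstoD) (use \<open>0 < c\<close> in simp)
  then obtain N where N: "\<And>k. N \<le> k \<Longrightarrow> C * norm (iter k - limit_point) < c"
    unfolding eventually_sequentially by blast
  have "norm (iter (Suc k) - limit_point) \<le> c * (norm (iter k - limit_point))\<^sup>2" if "N \<le> k" for k
  proof -
    have "norm (iter (Suc k) - limit_point) \<le> (C * norm (iter k - limit_point)) * (norm (iter k - limit_point))\<^sup>2"
      using C[of k] by (simp add: norm_minus_commute power2_eq_square power3_eq_cube mult_ac)
    also have "\<dots> \<le> c * (norm (iter k - limit_point))\<^sup>2"
      using N[OF that] by (intro mult_right_mono) auto
    finally show ?thesis .
  qed
  then show "\<exists>N. \<forall>k\<ge>N. norm (iter (Suc k) - limit_point) \<le> c * (norm (iter k - limit_point))\<^sup>2"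
    by blast
qed

end

section \<open>Convergence of the two-step Newton method\<close>

text \<open>At \<alpha> = 3 - 2 sqrt 2 both zeros of the majorant equal the radius of the ball
  assumed to lie in \<open>D\<close>. The limit may then sit on the sphere, outside the open set
  \<open>D\<close>, so being a zero is conditional on \<open>xs \<in> D\<close>. The majorant
  itself, taken as \<open>F\<close> with \<open>x0 = 0\<close>, has a double zero there, and its
  errors shrink only by a factor tending to \<open>3 / 8\<close>; superquadratic convergence is
  therefore stated for smaller \<alpha>.\<close>

theorem corollary3p3:
  fixes F :: "'a::banach \<Rightarrow> 'b::banach" and D :: "'a set" and x0 :: 'a
    and \<alpha> \<beta> \<gamma> S tstar tsstar H q :: real
  assumes "open D" and "convex D" and "analytic_operator_on F D"
    and "x0 \<in> D" and "nonsingular (fderiv F x0)"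
    and "\<gamma> = gamma_number F x0"
    and "\<beta> = norm (inv (fderiv F x0) (F x0))"
    and "\<alpha> = \<beta> * \<gamma>"
    and "ball x0 ((1 - 1 / sqrt 2) * (1 / \<gamma>)) \<subseteq> D"
    and "S = sqrt ((1 + \<alpha>)\<^sup>2 - 8 * \<alpha>)"
    and "tstar = (1 + \<alpha> - S) / (4 * \<gamma>)"
    and "tsstar = (1 + \<alpha> + S) / (4 * \<gamma>)"
    and "H = - (32 * \<gamma>) / (S * (3 - \<alpha> + S)\<^sup>2)"
    and "q = (S * (3 - \<alpha> + S)\<^sup>2 + 4 * (1 + \<alpha> - S)) / (S * (3 - \<alpha> + S)\<^sup>2 - 4 * (1 + \<alpha> - S))"
    and "0 < \<alpha>" and "\<alpha> \<le> 3 - 2 * sqrt 2"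
  shows "two_step_newton_well_defined F D x0 \<and>
    (\<exists>xs \<in> closure (ball x0 tstar).
       two_step_newton F x0 \<longlonglongrightarrow> xs \<and>
       (xs \<in> D \<longrightarrow> F xs = 0) \<and>
       (\<alpha> < 3 - 2 * sqrt 2 \<longrightarrow>
          xs \<in> D \<and> F xs = 0 \<and> converges_Q_superquadratically (two_step_newton F x0) xs) \<and>
       (\<forall>r. tstar \<le> r \<and> r < tsstar \<longrightarrow>
          (\<forall>z \<in> D \<inter> closure (ball x0 r). F z = 0 \<longrightarrow> z = xs)) \<and>
       (\<alpha> < 3 - root 3 2 - root 3 4 \<longrightarrow>
          converges_Q_cubically (two_step_newton F x0) xs \<and>
          (\<forall>k. norm (xs - two_step_newton F x0 (Suc k))
                \<le> q * H\<^sup>2 / 2 * norm (xs - two_step_newton F x0 k) ^ 3)))"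
proof -
  define A where "A = fderiv F x0"
  define L where "L = inv A"
  define G where "G x = L (F x)" for x
  have A: "nonsingular A" unfolding A_def by fact
  note A_inv = nonsingular_inv[OF A, folded L_def]
  have "0 \<le> \<beta>" using assms(7) by simp
  with assms(8,15) have \<beta>: "0 < \<beta>" and \<gamma>: "0 < \<gamma>" by (auto simp: zero_less_mult_iff)
  define r0 where "r0 = (1 - 1 / sqrt 2) * (1 / \<gamma>)"
  interpret smale_majorant \<beta> \<gamma> \<alpha> S tstar tsstar r0
    by unfold_locales (use \<beta> \<gamma> assms r0_def in auto)
  obtain B \<rho> where "normed_power_series B (\<lambda>n. if n = 0 then norm (L (F x0)) else \<gamma> ^ (n - 1)) (1 / \<gamma>)"
    and B1: "\<And>u. B 1 [u] = u" and \<rho>: "0 < \<rho>"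
    and local: "\<And>v. norm v < \<rho> \<Longrightarrow> L (F (x0 + v)) = normed_power_series.psum B v"
    using smale_power_series[OF assms(3,4,5,6) \<gamma>] unfolding L_def A_def by blast
  then interpret B: normed_power_series B "\<lambda>n. if n = 0 then norm (L (F x0)) else \<gamma> ^ (n - 1)" "1 / \<gamma>"
    by simp
  define U where "U = D \<inter> ball x0 (1 / \<gamma>)"
  define G' where "G' x = B.pderivative (x - x0)" for x
  have U_norm: "norm (x - x0) < 1 / \<gamma>" if "x \<in> U" for x
    using that by (auto simp: U_def dist_norm norm_minus_commute)
  have G_psum: "G x = B.psum (x - x0)" if "x \<in> U" for x
  proof -
    have "L (F (x0 + (x - x0))) = B.psum (x - x0)"
      by (rule B.analytic_eq_psum[OF assms(3,2) A_inv(2) \<rho> local assms(4)])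
        (use that U_norm in \<open>auto simp: U_def\<close>)
    then show ?thesis by (simp add: G_def)
  qed
  interpret N: two_step_newton_majorized \<beta> \<gamma> \<alpha> S tstar tsstar r0 G G' U x0
  proof unfold_locales
    show "convex U" unfolding U_def using assms(2) by (intro convex_Int convex_ball)
    have "r0 < 1 / \<gamma>" using r0_lt \<gamma> by (simp add: field_simps)
    then show "ball x0 r0 \<subseteq> U" using assms(9)[folded r0_def] by (auto simp: U_def)
    show "U \<subseteq> ball x0 (1 / \<gamma>)" by (simp add: U_def)
    show "(G has_derivative G' x) (at x)" if x: "x \<in> U" for x
    proof (rule has_derivative_transform_within_open)
      show "((\<lambda>z. B.psum (z - x0)) has_derivative G' x) (at x)"
        by (rule has_derivative_compose[of "\<lambda>z. z - x0" "\<lambda>z. z" x UNIV B.psum "G' x"])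
          (use B.has_derivative_psum[OF U_norm[OF x]] in \<open>auto intro!: derivative_eq_intros simp: G'_def\<close>)
      show "open U" unfolding U_def using assms(1) by auto
    qed (use x G_psum in auto)
    show "G' x0 u = u" for u by (simp add: G'_def B.pderivative_0 B1[unfolded One_nat_def])
    show "norm (G x0) = \<beta>" by (simp add: G_def L_def A_def assms(7))
    show "norm (G' w u - G' x u) \<le> (dmajorant \<gamma> (a + d) - dmajorant \<gamma> a) * norm u"
      if xw: "x \<in> U" "w \<in> U" and le: "norm (x - x0) \<le> a" "norm (w - x) \<le> d" and lt: "\<gamma> * (a + d) < 1"
      for x w a d u
      unfolding G'_def
    proof (rule B.pderivative_diff_bound[OF U_norm[OF xw(1)] U_norm[OF xw(2)]])
      have "0 \<le> a" "0 \<le> d" using le norm_ge_zero order_trans by blast+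
      then have "0 \<le> \<gamma> * a" "0 \<le> \<gamma> * (a + d)" "\<gamma> * a \<le> \<gamma> * (a + d)" using \<gamma> by auto
      then show "(\<lambda>n. (1 + real n) * (\<gamma> ^ n * ((a + d) ^ n - a ^ n))) sums (dmajorant \<gamma> (a + d) - dmajorant \<gamma> a)"
        using lt by (intro dmajorant_diff_sums) auto
      show "norm (B (Suc n) (replicate n (w - x0) @ [u]) - B (Suc n) (replicate n (x - x0) @ [u]))
          \<le> \<gamma> ^ n * ((a + d) ^ n - a ^ n) * norm u" for n
        using B.replicate_diff_bound_power[of n "[u]" "Suc n" "x - x0" a "w - x0" d] le by simp
    qed
    show "norm (G' w u - G' x u) \<le> 2 * \<gamma> / (1 - \<gamma> * s) ^ 3 * norm (w - x) * norm u"
      if xw: "x \<in> U" "w \<in> U" and le: "norm (x - x0) \<le> s" "norm (w - x0) \<le> s" and lt: "\<gamma> * s < 1"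
      for x w s u
      unfolding G'_def
    proof (rule B.pderivative_diff_bound[OF U_norm[OF xw(1)] U_norm[OF xw(2)]])
      have "0 \<le> s" using le norm_ge_zero order_trans by blast
      then show "(\<lambda>n. (1 + real n) * (\<gamma> ^ n * norm (w - x) * (real n * s ^ (n - 1)))) sums
          (2 * \<gamma> / (1 - \<gamma> * s) ^ 3 * norm (w - x))"
        using lt \<gamma> by (intro ddmajorant_sums) auto
      show "norm (B (Suc n) (replicate n (w - x0) @ [u]) - B (Suc n) (replicate n (x - x0) @ [u]))
          \<le> \<gamma> ^ n * norm (w - x) * (real n * s ^ (n - 1)) * norm u" for n
        using B.replicate_diff_bound_Lipschitz[of n "[u]" "Suc n" "x - x0" s "w - x0"] le by simp
    qed
  qed
  have F_G: "F x = A (G x)" for x by (simp add: G_def A_inv)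
  have fderiv_F: "fderiv F x = (\<lambda>u. A (G' x u))" if "x \<in> U" for x
    using bounded_linear.has_derivative[OF A_inv(1) N.deriv[OF that]]
    by (simp add: F_G[symmetric] frechet_derivative_at[symmetric])
  have iter: "N.iter k \<in> U" "nonsingular (G' (N.iter k))" "N.half_step (N.iter k) \<in> U" for k
  proof -
    have "norm (N.iter k - x0) \<le> N.scalar_iter k" "N.scalar_iter k < r0"
      using N.majorized_iter[of k] tstar_le_r0 by (auto simp: N.majorized_def)
    then show "N.iter k \<in> U" "nonsingular (G' (N.iter k))"
      using N.in_U N.nonsingular_deriv by auto
    show "N.half_step (N.iter k) \<in> U"
      using N.norm_half_step[OF N.majorized_iter, of k] tstar_le_r0 by (intro N.in_U) simp
  qed
  have fderiv_ns: "nonsingular (fderiv F (N.iter k))"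
    and fderiv_inv: "inv (fderiv F (N.iter k)) (F z) = inv (G' (N.iter k)) (G z)" for k z
    using nonsingular_compose[OF A iter(2)] by (simp_all add: fderiv_F[OF iter(1)] G_def L_def)
  have newton: "newton_step F (N.iter k) = N.half_step (N.iter k)" for k
    by (simp add: newton_step_def fderiv_inv N.half_step_def)
  have two_step: "two_step_newton F x0 = N.iter"
  proof
    show "two_step_newton F x0 k = N.iter k" for k
      by (induction k) (simp_all add: N.iter_Suc N.full_step_def newton fderiv_inv Let_def)
  qed
  let ?l = N.limit_point
  have l_in: "norm (?l - x0) \<le> tstar" using N.norm_limit_diff[of 0] by simp
  have in_U: "x \<in> U" if "x \<in> D" "\<gamma> * norm (x - x0) < 1" for x
    using that \<gamma> by (simp add: U_def dist_norm norm_minus_commute field_simps)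
  have l_zero: "F ?l = 0" if "?l \<in> D"
  proof -
    have "?l \<in> U" using that \<gamma>_mult_mono[OF l_in] \<gamma>_tstar_lt by (intro in_U) auto
    then show ?thesis using N.G_limit_point F_G linear_0[OF bounded_linear.linear[OF A_inv(1)]] by simp
  qed
  have cball: "z \<in> closure (ball x0 r) \<longleftrightarrow> norm (z - x0) \<le> r" if "0 < r" for z r
    using that by (simp add: dist_norm norm_minus_commute)
  have "two_step_newton_well_defined F D x0"
    using iter fderiv_ns by (auto simp: two_step_newton_well_defined_def two_step newton U_def Let_def)
  moreover have "?l \<in> closure (ball x0 tstar)" using l_in cball[OF tstar_pos] by simp
  moreover have strict: "?l \<in> D \<and> F ?l = 0 \<and> converges_Q_superquadratically N.iter ?l"
    if "\<alpha> < 3 - 2 * sqrt 2"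
  proof -
    have "?l \<in> D" using N.in_U[of ?l] l_in tstar_lt_r0[OF that] by (simp add: U_def)
    then show ?thesis using l_zero N.Q_superquadratic[OF tstar_lt_r0[OF that]] by simp
  qed
  moreover have "z = ?l" if r: "tstar \<le> r" "r < tsstar" and z: "z \<in> D" "z \<in> closure (ball x0 r)" "F z = 0" for r z
  proof (rule N.limit_point_unique)
    show "norm (z - x0) < tsstar" using z(2) r tstar_pos cball[of r z] by simp
    then show "z \<in> U" using z(1) \<gamma>_mult_strict_mono[of "norm (z - x0)" tsstar] tsstar_lt by (intro in_U) auto
    show "G z = 0" using z(3) linear_0[OF bounded_linear.linear[OF A_inv(2)]] by (simp add: G_def)
    \<comment> \<open>The range of \<open>r\<close> forces the two zeros apart, which excludes the
      critical \<alpha> and puts the limit inside the open ball of radius \<open>r0\<close>.\<close>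
    have "S \<noteq> 0" using r by (auto simp: assms(11,12))
    then show "tstar < r0" by (intro tstar_lt_r0 \<alpha>_strict)
  qed
  moreover have "converges_Q_cubically N.iter ?l \<and>
      (\<forall>k. norm (?l - N.iter (Suc k)) \<le> q * H\<^sup>2 / 2 * norm (?l - N.iter k) ^ 3)"
    if "\<alpha> < 3 - root 3 2 - root 3 4"
  proof -
    note thr = cubic_threshold[OF that]
    have "0 < \<gamma> * tstar" using \<gamma> tstar_pos by simp
    with thr have S: "S \<noteq> 0" by auto
    have t: "tstar < r0" by (intro tstar_lt_r0 \<alpha>_strict S)
    let ?K = "32 * \<gamma> / (S * (3 - \<alpha> + S)\<^sup>2)"
    have H: "?K\<^sup>2 = H\<^sup>2" by (simp add: assms(13) power_divide)
    have "1 + ?K / 2 * tstar \<le> q" unfolding assms(14) by (rule cubic_factor_le[OF thr])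
    then have le: "H\<^sup>2 / 2 * (1 + ?K / 2 * tstar) * e ^ 3 \<le> q * H\<^sup>2 / 2 * e ^ 3" if "0 \<le> e" for e
    proof -
      have "H\<^sup>2 / 2 * (1 + ?K / 2 * tstar) \<le> H\<^sup>2 / 2 * q"
        using \<open>1 + ?K / 2 * tstar \<le> q\<close> by (intro mult_left_mono) auto
      then have "H\<^sup>2 / 2 * (1 + ?K / 2 * tstar) * e ^ 3 \<le> H\<^sup>2 / 2 * q * e ^ 3"
        using that by (intro mult_right_mono) auto
      then show ?thesis by (simp add: mult_ac)
    qed
    have bound: "norm (?l - N.iter (Suc k)) \<le> q * H\<^sup>2 / 2 * norm (?l - N.iter k) ^ 3" for k
      using N.cubic_error_tstar[OF t, of k] le[of "norm (?l - N.iter k)"]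
      unfolding cubic_constant[OF S] H by simp
    have "0 \<le> ?K * tstar"
      using \<gamma> tstar_pos S_nonneg by simp
    then have "0 \<le> q" using \<open>1 + ?K / 2 * tstar \<le> q\<close> by simp
    then have "converges_Q_cubically N.iter ?l"
      unfolding converges_Q_cubically_def using N.iter_tendsto bound
      by (intro conjI exI[of _ "q * H\<^sup>2 / 2"] exI[of _ 0]) (auto simp: norm_minus_commute)
    then show ?thesis using bound by blast
  qed
  ultimately show ?thesis
    unfolding two_step using N.iter_tendsto l_zero by blast
qed

end
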